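(* Let $\mathrm{Mat}_n$ be one of the spaces $\mathrm{Sym}_n$, $\mathrm{Sq}_n$, or $\mathrm{Sk}_n$ (with $n=2k$ in the last case), let $N=\dim_{\mathbb C}\mathrm{Mat}_n$, and let $\Delta\subset \mathrm{Mat}_n$ be the set of all degenerate matrices. The complex link of $\Delta\subset\mathrm{Mat}_n$ is homotopy equivalent to a sphere $S^{N-2}$. If $\lambda$ is a positive real number, then this sphere may be taken to be the set of, respectively, (Sym) all degenerate real matrices $A\in\mathrm{Sym}_n$ with trace $n\lambda$ and all eigenvalues non-negative; (Sq) all degenerate Hermitian matrices $A\in\mathrm{Sq}_n$ with trace $n\lambda$ and all eigenvalues non-negative; (Sk) all degenerate quaternionic matrices $A\in\mathrm{Sk}_n$, $n=2k$, with skew trace $k\lambda$ and all skew eigenvalues non-negative.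
   Context: $\mathrm{Sq}_n$, $\mathrm{Sym}_n$, $\mathrm{Sk}_n$ are the complex vector spaces of, respectively, all square, all symmetric, and (for $n=2k$ even) all skew-symmetric complex $n\times n$ matrices. For $A=(a_{ij})\in\mathrm{Sk}_{2k}$ the skew trace is $\sum_{i=1}^k a_{2i-1,2i}$. Let $J_{2k}$ be the block-diagonal matrix with $k$ diagonal blocks $J_2=\begin{pmatrix}0&1\\ -1&0\end{pmatrix}$. The skew eigenvalues of $A\in\mathrm{Sk}_{2k}$ are the $k$ solutions $\lambda_1,\dots,\lambda_k$ of the equation $\mathrm{Pf}(A-\lambda J_{2k})=0$, where $\mathrm{Pf}$ is the Pfaffian. A matrix $A\in\mathrm{Sk}_{2k}$ is called quaternionic if each of its $2\times2$ cells $\begin{pmatrix}a_{2i-1,2j-1}&a_{2i-1,2j}\\ a_{2i,2j-1}&a_{2i,2j}\end{pmatrix}$, $1\le i,j\le k$, has the form $\begin{pmatrix}z&w\\ -\overline w&\overline z\end{pmatrix}$ with $z,w\in\mathbb C$. For $\alpha\in\mathbb C$ let $\mathrm{Tr}_\alpha\subset\mathrm{Mat}_n$ be the hyperplane of all matrices with trace $\alpha$ (skew trace $\alpha$ in the skew-symmetric case). The complex link of $\Delta$ is the set $\Delta\cap\mathrm{Tr}_\alpha$ with $\alpha\neq0$ fixed, that is, the set of all degenerate matrices with a fixed non-zero (skew) trace. The phrase "the sphere may be taken to be a set $S$" means that $S\subset\Delta\cap\mathrm{Tr}_\alpha$ (with $\alpha=n\lambda$ in the cases (Sym), (Sq), and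 $\alpha=k\lambda$ in the case (Sk)) is a topological sphere $S^{N-2}$ whose inclusion into $\Delta\cap\mathrm{Tr}_\alpha$ is a homotopy equivalence. *)

theory Defs
  imports "HOL-Analysis.Analysis"
begin

text \<open>
  The order of a square matrix is the cardinality of its index type.  Skew-symmetric matrices
  of order \<open>2k\<close> are indexed by \<open>'k \<times> 2\<close> with \<open>CARD('k) = k\<close>: the index \<open>(i, 1)\<close> stands for
  \<open>2i - 1\<close> and \<open>(i, 2)\<close> for \<open>2i\<close>.  (In the type \<open>2\<close> the numeral \<open>2\<close> equals \<open>0\<close>,
  and \<open>UNIV = {1, 2}\<close>.)
\<close>

definition sym_mats :: "(complex^'n^'n) set" where
  "sym_mats = {A. transpose A = A}"

definition sq_mats :: "(complex^'n^'n) set" where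
  "sq_mats = UNIV"

definition skew_mats :: "(complex^('k::finite \<times> 2)^('k \<times> 2)) set" where
  "skew_mats = {A. transpose A = - A}"


text \<open>The library has only the real vector space structure on complex matrices.\<close>

definition mat_scale :: "complex \<Rightarrow> complex^'m^'n \<Rightarrow> complex^'m^'n" where
  "mat_scale c A = (\<chi> i j. c * A $ i $ j)"

lemma vector_space_mat_scale: "vector_space mat_scale"
  by unfold_locales (simp_all add: mat_scale_def vec_eq_iff algebra_simps)

definition cdim :: "(complex^'m^'n) set \<Rightarrow> nat" where
  "cdim V = vector_space.dim mat_scale V"


definition degenerate :: "(complex^'n^'n) set \<Rightarrow> (complex^'n^'n) set" where
  "degenerate M = {A \<in> M. det A = 0}"

definition complex_link ::
    "(complex^'n^'n) set \<Rightarrow> (complex^'n^'n \<Rightarrow> complex) \<Rightarrow> complex \<Rightarrow> (complex^'n^'n) set" where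
  "complex_link M tr \<alpha> = {A \<in> degenerate M. tr A = \<alpha>}"


definition real_matrix :: "complex^'n^'n \<Rightarrow> bool" where
  "real_matrix A \<longleftrightarrow> (\<forall>i j. A $ i $ j \<in> \<real>)"

definition hermitian_matrix :: "complex^'n^'n \<Rightarrow> bool" where
  "hermitian_matrix A \<longleftrightarrow> (\<forall>i j. A $ j $ i = cnj (A $ i $ j))"

definition eigenvalue :: "complex^'n^'n \<Rightarrow> complex \<Rightarrow> bool" where
  "eigenvalue A \<mu> \<longleftrightarrow> (\<exists>v. v \<noteq> 0 \<and> A *v v = \<mu> *s v)"


definition skew_trace :: "complex^('k::finite \<times> 2)^('k \<times> 2) \<Rightarrow> complex" where
  "skew_trace A = (\<Sum>i\<in>UNIV. A $ (i, 1) $ (i, 2))"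

definition skew_unit :: "complex^('k::finite \<times> 2)^('k \<times> 2)" where
  "skew_unit = (\<chi> p q.
     if fst p = fst q \<and> snd p = 1 \<and> snd q = 2 then 1
     else if fst p = fst q \<and> snd p = 2 \<and> snd q = 1 then - 1
     else 0)"

text \<open>
  The usual sum over all permutations of the \<open>2k\<close> indices.  No ordering of \<open>'k\<close> is needed:
  reordering the pairs \<open>((i, 1), (i, 2))\<close> is an even permutation of the indices.
\<close>

definition pfaffian :: "complex^('k::finite \<times> 2)^('k \<times> 2) \<Rightarrow> complex" where
  "pfaffian A =
     (\<Sum>p | p permutes (UNIV :: ('k \<times> 2) set).
        of_int (sign p) * (\<Prod>i\<in>UNIV. A $ p (i, 1) $ p (i, 2)))
     / (2 ^ CARD('k) * fact CARD('k))"

definition skew_eigenvalue :: "complex^('k::finite \<times> 2)^('k \<times> 2) \<Rightarrow> complex \<Rightarrow> bool" where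
  "skew_eigenvalue A \<mu> \<longleftrightarrow> pfaffian (A - mat_scale \<mu> skew_unit) = 0"

definition quaternionic_matrix :: "complex^('k::finite \<times> 2)^('k \<times> 2) \<Rightarrow> bool" where
  "quaternionic_matrix A \<longleftrightarrow>
     (\<forall>i j. \<exists>z w. A $ (i, 1) $ (j, 1) = z \<and> A $ (i, 1) $ (j, 2) = w \<and>
                  A $ (i, 2) $ (j, 1) = - cnj w \<and> A $ (i, 2) $ (j, 2) = cnj z)"


text \<open>
  The sphere \<open>S\<^sup>d\<close> for integer \<open>d\<close>; \<open>S\<^sup>-\<^sup>1\<close> is the empty space, which occurs for matrix spaces of
  dimension one, where the complex link is empty.
\<close>

definition sphere_space :: "int \<Rightarrow> (nat \<Rightarrow> real) topology" where
  "sphere_space d = (if d < 0 then trivial_topology else nsphere (nat d))"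

definition homotopy_equivalence_map :: "'a topology \<Rightarrow> 'b topology \<Rightarrow> ('a \<Rightarrow> 'b) \<Rightarrow> bool" where
  "homotopy_equivalence_map X Y f \<longleftrightarrow>
     continuous_map X Y f \<and>
     (\<exists>g. continuous_map Y X g \<and>
          homotopic_with (\<lambda>h. True) X X (g \<circ> f) id \<and>
          homotopic_with (\<lambda>h. True) Y Y (f \<circ> g) id)"

definition sphere_may_be_taken :: "'a::topological_space set \<Rightarrow> int \<Rightarrow> 'a set \<Rightarrow> bool" where
  "sphere_may_be_taken L d S \<longleftrightarrow>
     S \<subseteq> L \<and>
     top_of_set S homeomorphic_space sphere_space d \<and>
     homotopy_equivalence_map (top_of_set S) (top_of_set L) id"

end

theory Submission
  imports Defs "HOL-Homology.Invariance_of_Domain" "HOL-Computational_Algebra.Polynomial"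
begin

text \<open>
  Everything happens in a complex vector space \<open>V\<close> of square matrices that contains the identity
  and is closed under \<open>A \<mapsto> A\<^sup>*\<close> and under \<open>A \<mapsto> |A| + |A\<^sup>*|\<close>, where \<open>|A|\<close> is the positive
  semidefinite square root of \<open>A\<^sup>* A\<close> (locale \<open>star_space\<close>).  All square matrices and the symmetric
  matrices form such spaces.  So do the matrices \<open>A J\<^sup>-\<^sup>1\<close> with \<open>A\<close> skew-symmetric and
  \<open>J\<close> the standard symplectic matrix; in the three cases the positive semidefinite members of \<open>V\<close>
  correspond to the real, Hermitian and quaternionic matrices with non-negative (skew) eigenvalues.

  \<^emph>\<open>The homotopy equivalence.\<close>  Let \<open>A\<close> be degenerate with positive trace and let \<open>A = U |A|\<close> be a
  polar decomposition.  Then \<open>|A\<^sup>*| = U |A| U\<^sup>*\<close>, and hence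
    \<open>A + t (|A| + |A\<^sup>*|) + t\<^sup>2 A\<^sup>* = (U + t) |A| (1 + t U\<^sup>*)\<close>  for real \<open>t\<close>.
  The left side depends continuously on \<open>A\<close> and stays in \<open>V\<close>; the right side shows that it stays
  degenerate, although \<open>U\<close> does not depend continuously on \<open>A\<close>.  For \<open>t \<ge> 0\<close> its trace is a
  positive real number, so it can be rescaled to the trace of \<open>A\<close>.  At \<open>t = 1\<close> it equals
  \<open>(U + 1) |A| (U + 1)\<^sup>*\<close>, which is positive semidefinite; and if \<open>A\<close> is already positive
  semidefinite, it is \<open>(1 + t)\<^sup>2 A\<close>, so the rescaled matrix does not move.  Thus the complex link
  deformation retracts onto its positive semidefinite part
  (\<open>bend_factorization\<close>, \<open>psd_link_homotopy_equivalence\<close>).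

  \<^emph>\<open>The sphere.\<close>  The positive semidefinite matrices in \<open>V\<close> of trace \<open>r > 0\<close> form a compact convex
  body whose relative boundary consists of its degenerate members.  A real basis of the Hermitian
  part of \<open>V\<close> is a complex basis of \<open>V\<close>, so the body has real dimension \<open>N - 1\<close> for
  \<open>N = dim V\<close>, and its boundary is a sphere of dimension \<open>N - 2\<close>
  (\<open>cdim_eq_dim_herm\<close>, \<open>rel_frontier_density\<close>, \<open>sphere_in_complex_link\<close>).

  \<^emph>\<open>Skew eigenvalues.\<close>  The remaining point is that the skew eigenvalues of \<open>A\<close> are the eigenvalues
  of \<open>B = A J\<^sup>-\<^sup>1\<close>.  This follows from \<open>Pf (B J)\<^sup>2 = det B (Pf J)\<^sup>2\<close>, which is immediate from
  \<open>Pf (C M C\<^sup>T) = det C Pf M\<close> when \<open>B\<close> is the square of a matrix \<open>C\<close> with \<open>J C\<^sup>T J\<^sup>-\<^sup>1 = C\<close>.  Every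
  \<open>B + s\<^sup>2\<close> with \<open>s\<close> real and large is such a square, and both sides are polynomials in \<open>s\<close>
  (\<open>pf_sum_congruence\<close>, \<open>pf_sum_square\<close>).
\<close>

section \<open>Complex matrices and their adjoints\<close>

definition adj :: "complex^'n^'n \<Rightarrow> complex^'n^'n" where
  "adj A = (\<chi> i j. cnj (A $ j $ i))"

lemma adj_adj [simp]: "adj (adj A) = A"
  by (simp add: adj_def vec_eq_iff)

lemma adj_mult: "adj (A ** B) = adj B ** adj A"
  by (simp add: adj_def vec_eq_iff matrix_matrix_mult_def mult.commute)

lemma adj_add: "adj (A + B) = adj A + adj B"
  by (simp add: adj_def vec_eq_iff)

lemma adj_diff: "adj (A - B) = adj A - adj B"
  by (simp add: adj_def vec_eq_iff)

lemma adj_scaleR: "adj (c *\<^sub>R A) = c *\<^sub>R adj A"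
  by (simp add: adj_def vec_eq_iff)

lemma adj_mat_scale: "adj (mat_scale c A) = mat_scale (cnj c) (adj A)"
  by (simp add: adj_def mat_scale_def vec_eq_iff)

lemma adj_mat: "adj (mat c) = mat (cnj c)"
  by (simp add: adj_def vec_eq_iff mat_def)

lemma transpose_adj: "transpose (adj A) = adj (transpose A)"
  by (simp add: adj_def vec_eq_iff transpose_def)

lemma hermitian_iff_adj: "hermitian_matrix A \<longleftrightarrow> adj A = A"
  unfolding hermitian_matrix_def adj_def vec_eq_iff vec_lambda_beta by (metis complex_cnj_cnj)

lemma trace_adj: "trace (adj A) = cnj (trace A)"
  by (simp add: trace_def adj_def)

lemma trace_scaleR: "trace (c *\<^sub>R A) = c *\<^sub>R trace (A :: complex^'n^'n)"
  by (simp add: trace_def scaleR_sum_right)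

lemma mat_scale_of_real: "mat_scale (of_real c) A = c *\<^sub>R A"
  by (simp add: mat_scale_def vec_eq_iff scaleR_conv_of_real[where 'a = complex])

lemma mult_mat_scale: "A ** mat_scale c B = mat_scale c (A ** B)"
  by (simp add: mat_scale_def vec_eq_iff matrix_matrix_mult_def sum_distrib_left mult_ac)

lemma mat_scale_mult: "mat_scale c A ** B = mat_scale c (A ** B)"
  by (simp add: mat_scale_def vec_eq_iff matrix_matrix_mult_def sum_distrib_left mult_ac)

lemma mat_eq_mat_scale: "mat c = mat_scale c (mat 1)"
  by (simp add: mat_def mat_scale_def vec_eq_iff)

lemma mult_scaleR: "A ** (c *\<^sub>R B) = c *\<^sub>R (A ** B)" for A B :: "complex^'n^'n"
  by (simp flip: mat_scale_of_real add: mult_mat_scale)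

lemma scaleR_mult: "(c *\<^sub>R A) ** B = c *\<^sub>R (A ** B)" for A B :: "complex^'n^'n"
  by (simp flip: mat_scale_of_real add: mat_scale_mult)

lemma scaleR_mult_vec: "(c *\<^sub>R A) *v x = c *\<^sub>R (A *v x)" for A :: "complex^'n^'n"
  by (simp add: vec_eq_iff matrix_vector_mult_def scaleR_sum_right)

lemma mat_mult_vec: "mat c *v x = c *s x" for x :: "complex^'n"
  by (simp add: vec_eq_iff matrix_vector_mult_def mat_def if_distrib [where f = "\<lambda>y. y * _"] cong: if_cong)

lemma mult_vec_scaleR: "A *v (c *\<^sub>R x) = c *\<^sub>R (A *v x)" for A :: "complex^'n^'n"
  by (simp add: vec_eq_iff matrix_vector_mult_def scaleR_sum_right)

lemma of_real_smult: "of_real c *s x = c *\<^sub>R x" for x :: "complex^'n"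
  by (simp add: vec_eq_iff scaleR_conv_of_real[where 'a = complex])

lemma matrix_add_rdistrib: "(A + B) ** C = A ** C + B ** C" for A B C :: "complex^'n^'n"
  by (simp add: vec_eq_iff matrix_matrix_mult_def distrib_right sum.distrib)

lemma matrix_diff_ldistrib: "A ** (B - C) = A ** B - A ** C" for A B C :: "complex^'n^'n"
  by (simp add: vec_eq_iff matrix_matrix_mult_def right_diff_distrib sum_subtractf)

lemma matrix_diff_rdistrib: "(A - B) ** C = A ** C - B ** C" for A B C :: "complex^'n^'n"
  by (simp add: vec_eq_iff matrix_matrix_mult_def left_diff_distrib sum_subtractf)

text \<open>
  The inner product on complex vectors is the real part of the Hermitian one.  For it the conjugate
  transpose is the adjoint, so the arguments about Hermitian matrices below can be carried out in a
  real Euclidean space.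
\<close>
lemma inner_mult_vec: "(A *v x) \<bullet> y = x \<bullet> (adj A *v y)"
proof -
  have inner: "a \<bullet> b = Re (cnj a * b)" for a b :: complex
    by (simp add: inner_complex_def)
  have "(A *v x) \<bullet> y = Re (\<Sum>i\<in>UNIV. \<Sum>j\<in>UNIV. cnj (A $ i $ j) * cnj (x $ j) * y $ i)"
    by (simp add: inner_vec_def inner matrix_vector_mult_def sum_distrib_right)
  also have "\<dots> = Re (\<Sum>j\<in>UNIV. \<Sum>i\<in>UNIV. cnj (A $ i $ j) * cnj (x $ j) * y $ i)"
    by (subst sum.swap) simp
  also have "\<dots> = x \<bullet> (adj A *v y)"
    by (simp add: inner_vec_def inner matrix_vector_mult_def sum_distrib_left adj_def mult_ac)
  finally show ?thesis .
qed

lemma inner_eq_Re_trace: "A \<bullet> B = Re (trace (adj A ** B))"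
proof -
  have inner: "a \<bullet> b = Re (cnj a * b)" for a b :: complex
    by (simp add: inner_complex_def)
  have "A \<bullet> B = Re (\<Sum>i\<in>UNIV. \<Sum>j\<in>UNIV. cnj (A $ i $ j) * B $ i $ j)"
    by (simp add: inner_vec_def inner)
  also have "\<dots> = Re (trace (adj A ** B))"
    by (subst sum.swap) (simp add: trace_def matrix_matrix_mult_def adj_def)
  finally show ?thesis .
qed

lemma det_eq_0_iff_kernel: "det A = 0 \<longleftrightarrow> (\<exists>v. v \<noteq> 0 \<and> A *v v = 0)" for A :: "complex^'n^'n"
  using matrix_left_invertible_ker[of A] invertible_det_nz[of A] by (auto simp: invertible_left_inverse)

lemma continuous_on_matrix_mult [continuous_intros]:
  fixes f g :: "'a::topological_space \<Rightarrow> complex^'n^'n"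
  assumes "continuous_on S f" "continuous_on S g"
  shows "continuous_on S (\<lambda>x. f x ** g x)"
  unfolding matrix_matrix_mult_def by (intro continuous_intros assms)

lemma continuous_on_matrix_vector_mult [continuous_intros]:
  fixes f :: "'a::topological_space \<Rightarrow> complex^'n^'n"
  assumes "continuous_on S f" "continuous_on S g"
  shows "continuous_on S (\<lambda>x. f x *v g x)"
  unfolding matrix_vector_mult_def by (intro continuous_intros assms)

lemma continuous_on_adj [continuous_intros]:
  "continuous_on S f \<Longrightarrow> continuous_on S (\<lambda>x. adj (f x))"
  unfolding adj_def by (intro continuous_intros)

lemma continuous_on_trace [continuous_intros]:
  fixes f :: "'a::topological_space \<Rightarrow> complex^'n^'n"
  shows "continuous_on S f \<Longrightarrow> continuous_on S (\<lambda>x. trace (f x))"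
  unfolding trace_def by (intro continuous_intros)

lemma continuous_on_mat_scale [continuous_intros]:
  "continuous_on S f \<Longrightarrow> continuous_on S (\<lambda>x. mat_scale c (f x))"
  unfolding mat_scale_def by (intro continuous_intros)

section \<open>Positive semidefinite matrices\<close>

text \<open>
  Positivity is expressed by the real inner product.  This loses nothing, because the Hermitian form
  of a matrix with \<open>adj A = A\<close> takes real values.
\<close>
definition psd :: "complex^'n^'n \<Rightarrow> bool" where
  "psd A \<longleftrightarrow> adj A = A \<and> (\<forall>v. 0 \<le> v \<bullet> (A *v v))"

text \<open>
  A vector where the form of \<open>P\<close> vanishes minimises it, so the first variation \<open>2 (w \<bullet> P v)\<close> in every
  direction \<open>w\<close> vanishes; take \<open>w = P v\<close>.
\<close>
lemma psd_kernel:
  assumes "psd P" and "v \<bullet> (P *v v) = 0"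
  shows "P *v v = 0"
proof -
  define w where "w = P *v v"
  define c where "c = w \<bullet> (P *v w)"
  have sym: "v \<bullet> (P *v w) = w \<bullet> w"
    using inner_mult_vec[of P v w] assms(1) by (simp add: w_def psd_def)
  have quad: "0 \<le> t * (2 * (w \<bullet> w) + t * c)" for t
  proof -
    have "0 \<le> (v + t *\<^sub>R w) \<bullet> (P *v (v + t *\<^sub>R w))"
      using assms(1) by (simp add: psd_def)
    also have "\<dots> = t * (2 * (w \<bullet> w) + t * c)"
      using assms(2) sym
      by (simp add: mult_vec_scaleR w_def[symmetric] c_def[symmetric] algebra_simps)
    finally show ?thesis .
  qed
  have "w \<bullet> w \<le> 0"
  proof (rule ccontr)
    assume "\<not> w \<bullet> w \<le> 0"
    define a where "a = w \<bullet> w"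
    have a: "a > 0" using \<open>\<not> _\<close> unfolding a_def by linarith
    define t where "t = - a / (\<bar>c\<bar> + 1)"
    have t: "t < 0" using a by (simp add: t_def)
    have "\<bar>t * c\<bar> \<le> a"
      using a by (simp add: t_def abs_mult divide_simps) 
    then have "2 * a + t * c > 0" using a by (simp add: abs_le_iff)
    then show False using quad[of t] t mult_neg_pos[of t "2 * a + t * c"] by (simp add: a_def)
  qed
  then have "w = 0" by (metis inner_gt_zero_iff not_le)
  then show ?thesis by (simp add: w_def)
qed

text \<open>
  A minimiser \<open>v\<close> of the Rayleigh quotient on the unit sphere with minimum \<open>m\<close> is in the kernel of the
  positive semidefinite matrix \<open>D - m\<close>.  This is all that is used of the spectral theorem.
\<close>
lemma hermitian_least_eigenvalue:
  fixes D :: "complex^'n^'n"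
  assumes "adj D = D"
  obtains v m where "v \<noteq> 0" "D *v v = m *\<^sub>R v" "\<And>w. m * (w \<bullet> w) \<le> w \<bullet> (D *v w)"
proof -
  have "continuous_on (sphere 0 1) (\<lambda>w :: complex^'n. w \<bullet> (D *v w))"
    by (intro continuous_intros linear_continuous_on) (simp add: linear_conv_bounded_linear[symmetric])
  moreover have "sphere 0 1 \<noteq> ({} :: (complex^'n) set)" by simp
  ultimately obtain v where v: "norm v = 1"
    and min: "\<And>w. norm w = 1 \<Longrightarrow> v \<bullet> (D *v v) \<le> w \<bullet> (D *v w)"
    using continuous_attains_inf[of "sphere 0 1" "\<lambda>w :: complex^'n. w \<bullet> (D *v w)"]
    by (auto simp: dist_norm)
  define m where "m = v \<bullet> (D *v v)"
  have le: "m * (w \<bullet> w) \<le> w \<bullet> (D *v w)" for w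
  proof (cases "w = 0")
    case False
    have "m \<le> (w /\<^sub>R norm w) \<bullet> (D *v (w /\<^sub>R norm w))"
      unfolding m_def by (rule min) (use False in simp)
    also have "\<dots> = (w \<bullet> (D *v w)) / (norm w)\<^sup>2"
      by (simp add: mult_vec_scaleR divide_simps power2_eq_square)
    finally show ?thesis
      using False by (simp add: divide_simps dot_square_norm mult.commute)
  qed simp
  define P where "P = D - mat (of_real m)"
  have P: "P *v w = D *v w - m *\<^sub>R w" for w
    by (simp add: P_def matrix_vector_mult_diff_rdistrib mat_mult_vec of_real_smult)
  have "psd P"
    unfolding psd_def
  proof
    show "adj P = P" using assms by (simp add: P_def adj_diff adj_mat)
    show "\<forall>v. 0 \<le> v \<bullet> (P *v v)" using le by (simp add: P inner_diff_right)
  qed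
  moreover have "v \<bullet> (P *v v) = 0"
    using v by (simp add: P inner_diff_right m_def dot_square_norm)
  ultimately have "P *v v = 0" by (rule psd_kernel)
  then have "D *v v = m *\<^sub>R v" by (simp add: P)
  moreover have "v \<noteq> 0" using v by auto
  ultimately show ?thesis using that le by blast
qed

lemma psd_iff_eigenvalues:
  assumes "adj A = A"
  shows "psd A \<longleftrightarrow> (\<forall>\<mu>. eigenvalue A \<mu> \<longrightarrow> \<mu> \<in> \<real>\<^sub>\<ge>\<^sub>0)"
proof
  assume psd: "psd A"
  show "\<forall>\<mu>. eigenvalue A \<mu> \<longrightarrow> \<mu> \<in> \<real>\<^sub>\<ge>\<^sub>0"
  proof (intro allI impI)
    fix \<mu> assume "eigenvalue A \<mu>"
    then obtain v where v: "v \<noteq> 0" "A *v v = \<mu> *s v" by (auto simp: eigenvalue_def)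
    have inner: "v \<bullet> (c *s v) = Re c * (v \<bullet> v)" for c
      by (simp add: inner_vec_def inner_complex_def sum_distrib_left algebra_simps)
    have "0 \<le> Re \<mu> * (v \<bullet> v)"
      using psd v(2) inner[of \<mu>] by (metis psd_def)
    then have "Re \<mu> \<ge> 0"
      using v(1) inner_gt_zero_iff[of v] by (meson not_le zero_le_mult_iff)
    moreover have "Im \<mu> = 0"
    proof -
      have *: "A *v (c *s v) = c *s (A *v v)" for c
        by (simp add: vec_eq_iff matrix_vector_mult_def sum_distrib_left mult_ac)
      have "(A *v (\<i> *s v)) \<bullet> v = (\<i> *s v) \<bullet> (A *v v)"
        using assms by (simp add: inner_mult_vec)
      then have "((\<i> * \<mu>) *s v) \<bullet> v = (\<i> *s v) \<bullet> (\<mu> *s v)"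
        by (simp add: * v vector_smult_assoc)
      moreover have "((\<i> * \<mu>) *s v) \<bullet> v = - Im \<mu> * (v \<bullet> v)"
        by (subst inner_commute) (simp add: inner)
      moreover have "(\<i> *s v) \<bullet> (\<mu> *s v) = Im \<mu> * (v \<bullet> v)"
        by (simp add: inner_vec_def inner_complex_def sum_distrib_left algebra_simps)
      ultimately show ?thesis using v(1) by simp
    qed
    ultimately show "\<mu> \<in> \<real>\<^sub>\<ge>\<^sub>0" by (simp add: complex_nonneg_Reals_iff)
  qed
next
  assume ev: "\<forall>\<mu>. eigenvalue A \<mu> \<longrightarrow> \<mu> \<in> \<real>\<^sub>\<ge>\<^sub>0"
  obtain v m where "v \<noteq> 0" "A *v v = m *\<^sub>R v" and le: "\<And>w. m * (w \<bullet> w) \<le> w \<bullet> (A *v w)"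
    using hermitian_least_eigenvalue[OF assms] by blast
  then have "eigenvalue A (of_real m)" by (auto simp: eigenvalue_def of_real_smult)
  then have "m \<ge> 0" using ev by (auto simp: complex_nonneg_Reals_iff)
  then show "psd A"
    using assms order_trans[OF mult_nonneg_nonneg le] by (simp add: psd_def)
qed

text \<open>
  For \<open>D = M - N\<close> the hypothesis gives \<open>D M + N D = 0\<close>.  On an eigenvector \<open>u\<close> of \<open>D\<close> with eigenvalue
  \<open>m\<close> this reads \<open>m (u \<bullet> M u + u \<bullet> N u) = 0\<close>, which forces \<open>m = 0\<close>.  So the least eigenvalues of \<open>D\<close>
  and of \<open>-D\<close> are zero.
\<close>
lemma psd_sqrt_unique:
  assumes "psd M" "psd N" "M ** M = N ** N"
  shows "M = N"
proof -
  have le: "v \<bullet> ((M - N) *v v) \<ge> 0"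
    if MN: "psd M" "psd N" "M ** M = N ** N" for M N :: "complex^'n^'n" and v
  proof -
    define D where "D = M - N"
    have "adj D = D" using MN by (simp add: D_def adj_diff psd_def)
    then obtain u m where u: "u \<noteq> 0" "D *v u = m *\<^sub>R u"
      and min: "\<And>w. m * (w \<bullet> w) \<le> w \<bullet> (D *v w)"
      using hermitian_least_eigenvalue by blast
    \<comment> \<open>the anticommutator identity behind \<open>M\<^sup>2 - N\<^sup>2 = 0\<close>\<close>
    have "D ** M + N ** D = 0"
      using MN(3) by (simp add: D_def matrix_diff_ldistrib matrix_diff_rdistrib)
    then have "0 = u \<bullet> ((D ** M + N ** D) *v u)" by simp
    also have "\<dots> = (D *v u) \<bullet> (M *v u) + u \<bullet> (N *v (D *v u))"
      using \<open>adj D = D\<close> inner_mult_vec[of D u "M *v u"]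
      by (simp add: matrix_vector_mult_add_rdistrib inner_add_right matrix_vector_mul_assoc)
    also have "\<dots> = m * (u \<bullet> (M *v u) + u \<bullet> (N *v u))"
      by (simp add: u mult_vec_scaleR distrib_left)
    finally have *: "m = 0 \<or> u \<bullet> (M *v u) + u \<bullet> (N *v u) = 0" by auto
    have "m = 0"
    proof (rule ccontr)
      assume "m \<noteq> 0"
      moreover have "u \<bullet> (M *v u) \<ge> 0" "u \<bullet> (N *v u) \<ge> 0" using MN by (auto simp: psd_def)
      ultimately have "u \<bullet> (M *v u) = 0" "u \<bullet> (N *v u) = 0" using * by auto
      then have "u \<bullet> (D *v u) = 0"
        by (simp add: D_def matrix_vector_mult_diff_rdistrib inner_diff_right)
      then show False using u \<open>m \<noteq> 0\<close> by simp
    qed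
    then show ?thesis using min[of v] by (simp add: D_def)
  qed
  have "v \<bullet> ((M - N) *v v) = 0" for v
    using le[OF assms, of v] le[OF assms(2,1) assms(3)[symmetric], of v]
    by (simp add: matrix_vector_mult_diff_rdistrib inner_diff_right)
  moreover have "psd (M - N)"
    using le[OF assms] assms by (simp add: psd_def adj_diff)
  ultimately have "(M - N) *v v = 0" for v by (intro psd_kernel)
  then have "M *v v = N *v v" for v
    by (simp add: matrix_vector_mult_diff_rdistrib)
  then show ?thesis by (simp add: matrix_eq)
qed

section \<open>Polar decomposition and the absolute value of a matrix\<close>

lemma closed_psd: "closed {T. psd T}"
proof -
  have "closed {T :: complex^'n^'n. adj T = T}"
    by (intro closed_Collect_eq continuous_intros)
  moreover have "closed {T :: complex^'n^'n. 0 \<le> v \<bullet> (T *v v)}" for v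
    by (intro closed_Collect_le continuous_intros)
  ultimately show ?thesis
    unfolding psd_def by (intro closed_Collect_conj closed_Collect_all)
qed

lemma compact_unitary: "compact {U. adj U ** U = (mat 1 :: complex^'n^'n)}"
proof -
  have "closed {U. adj U ** U = (mat 1 :: complex^'n^'n)}"
    by (intro closed_Collect_eq continuous_intros)
  moreover have "norm U \<le> sqrt (real CARD('n))" if "adj U ** U = mat 1" for U :: "complex^'n^'n"
    using that by (simp add: norm_eq_sqrt_inner inner_eq_Re_trace trace_I)
  ultimately show ?thesis
    by (auto simp: compact_eq_bounded_closed bounded_iff)
qed

text \<open>
  The complex value \<open>v\<^sup>* T v\<close>.  The real inner product sees only its real part, but a matrix
  is recognised as Hermitian by the vanishing of the imaginary part.
\<close>
definition hermitian_form :: "complex^'n^'n \<Rightarrow> complex^'n \<Rightarrow> complex" where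
  "hermitian_form T v = (\<Sum>i\<in>UNIV. cnj (v $ i) * (T *v v) $ i)"

lemma Re_hermitian_form: "Re (hermitian_form T v) = v \<bullet> (T *v v)"
  by (simp add: hermitian_form_def inner_vec_def inner_complex_def)

lemma hermitian_form_adj: "hermitian_form (adj T) v = cnj (hermitian_form T v)"
proof -
  have "hermitian_form (adj T) v = (\<Sum>i\<in>UNIV. \<Sum>j\<in>UNIV. cnj (v $ i) * cnj (T $ j $ i) * v $ j)"
    by (simp add: hermitian_form_def matrix_vector_mult_def adj_def sum_distrib_left mult_ac)
  also have "\<dots> = (\<Sum>j\<in>UNIV. \<Sum>i\<in>UNIV. cnj (v $ i) * cnj (T $ j $ i) * v $ j)"
    by (rule sum.swap)
  also have "\<dots> = cnj (hermitian_form T v)"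
    by (simp add: hermitian_form_def matrix_vector_mult_def sum_distrib_left mult_ac)
  finally show ?thesis .
qed

lemma hermitian_form_diff: "hermitian_form (S - T) v = hermitian_form S v - hermitian_form T v"
  by (simp add: hermitian_form_def matrix_vector_mult_diff_rdistrib right_diff_distrib sum_subtractf)

lemma hermitian_form_mat_scale: "hermitian_form (mat_scale c T) v = c * hermitian_form T v"
  by (simp add: hermitian_form_def mat_scale_def matrix_vector_mult_def sum_distrib_left mult_ac)

lemma hermitian_form_scaleR: "hermitian_form T (c *\<^sub>R v) = of_real (c\<^sup>2) * hermitian_form T v"
  by (simp add: hermitian_form_def mult_vec_scaleR sum_distrib_left power2_eq_square scaleR_conv_of_real[where 'a = complex] mult_ac)

text \<open>
  The matrix \<open>F = \<i> (T - T\<^sup>*)\<close> is Hermitian with vanishing form, hence it is zero, and \<open>T\<close> is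
  Hermitian.
\<close>
lemma psd_if_hermitian_form_nonneg:
  assumes "\<And>v. norm v = 1 \<Longrightarrow> hermitian_form T v \<in> \<real>\<^sub>\<ge>\<^sub>0"
  shows "psd T"
proof -
  have nonneg: "hermitian_form T v \<in> \<real>\<^sub>\<ge>\<^sub>0" for v
  proof (cases "v = 0")
    case False
    have "hermitian_form T v = of_real ((norm v)\<^sup>2) * hermitian_form T (v /\<^sub>R norm v)"
      using False hermitian_form_scaleR[of T "norm v" "v /\<^sub>R norm v"] by simp
    moreover have "hermitian_form T (v /\<^sub>R norm v) \<in> \<real>\<^sub>\<ge>\<^sub>0"
      using False by (intro assms) simp
    ultimately show ?thesis
      by (simp add: complex_nonneg_Reals_iff del: of_real_power)
  qed (simp add: hermitian_form_def)
  define F where "F = mat_scale \<i> (T - adj T)"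
  have zero: "v \<bullet> (F *v v) = 0" for v
    using nonneg[of v]
    by (simp add: F_def hermitian_form_mat_scale hermitian_form_diff hermitian_form_adj complex_nonneg_Reals_iff flip: Re_hermitian_form)
  have "adj F = F"
    by (simp add: F_def adj_mat_scale adj_diff) (simp add: mat_scale_def vec_eq_iff algebra_simps)
  with zero have "psd F" by (simp add: psd_def)
  then have "F *v v = 0" for v using zero psd_kernel by blast
  then have "F = 0" by (simp add: matrix_eq)
  then have "adj T = T" by (simp add: F_def mat_scale_def vec_eq_iff)
  then show ?thesis
    using nonneg by (auto simp: psd_def complex_nonneg_Reals_iff simp flip: Re_hermitian_form)
qed

text \<open>
  Choose a unitary \<open>U\<close> that maximises the real part of the trace of \<open>U A\<close>, and let \<open>T = U A\<close>.
  Multiplying \<open>U\<close> by the unitary \<open>1 - (1 - w) v v\<^sup>*\<close>, where \<open>v\<close> and \<open>w\<close> have norm one, changes the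
  trace by \<open>-(1 - w) v\<^sup>* T v\<close>.  By maximality \<open>Re (w v\<^sup>* T v) \<le> Re (v\<^sup>* T v)\<close> for all such \<open>w\<close>, so
  \<open>v\<^sup>* T v\<close> is a nonnegative real number.
\<close>
lemma polar_decomposition:
  fixes A :: "complex^'n^'n"
  obtains U T where "adj U ** U = mat 1" "psd T" "A = U ** T"
proof -
  define \<U> where "\<U> = {U. adj U ** U = (mat 1 :: complex^'n^'n)}"
  have "mat 1 \<in> \<U>" by (simp add: \<U>_def adj_mat)
  moreover have "continuous_on \<U> (\<lambda>U. Re (trace (U ** A)))" by (intro continuous_intros)
  moreover have "compact \<U>" unfolding \<U>_def by (rule compact_unitary)
  ultimately obtain U where U: "U \<in> \<U>"
    and max: "\<And>W. W \<in> \<U> \<Longrightarrow> Re (trace (W ** A)) \<le> Re (trace (U ** A))"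
    using continuous_attains_sup[of \<U> "\<lambda>U. Re (trace (U ** A))"] by blast
  define T where "T = U ** A"
  have "hermitian_form T v \<in> \<real>\<^sub>\<ge>\<^sub>0" if v: "norm v = 1" for v
  proof -
    define E :: "complex^'n^'n" where "E = (\<chi> i j. v $ i * cnj (v $ j))"
    have vv: "(\<Sum>k\<in>UNIV. cnj (v $ k) * v $ k) = 1"
    proof -
      have "(\<Sum>k\<in>UNIV. cnj (v $ k) * v $ k) = of_real (v \<bullet> v)"
        unfolding inner_vec_def of_real_sum
        by (intro sum.cong refl) (simp add: complex_eq_iff inner_complex_def)
      then show ?thesis using v by (simp add: dot_square_norm)
    qed
    have EE: "E ** E = E"
    proof -
      have "(E ** E) $ i $ j = (v $ i * cnj (v $ j)) * (\<Sum>k\<in>UNIV. cnj (v $ k) * v $ k)" for i j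
        by (simp add: E_def matrix_matrix_mult_def sum_distrib_left mult_ac)
      then show ?thesis by (simp add: vv) (simp add: vec_eq_iff E_def)
    qed
    have adjE: "adj E = E" by (simp add: E_def adj_def vec_eq_iff)
    have trE: "trace (E ** T) = hermitian_form T v"
    proof -
      have "trace (E ** T) = (\<Sum>i\<in>UNIV. \<Sum>k\<in>UNIV. v $ i * cnj (v $ k) * T $ k $ i)"
        by (simp add: trace_def matrix_matrix_mult_def E_def)
      also have "\<dots> = (\<Sum>k\<in>UNIV. \<Sum>i\<in>UNIV. v $ i * cnj (v $ k) * T $ k $ i)"
        by (rule sum.swap)
      also have "\<dots> = hermitian_form T v"
        by (simp add: hermitian_form_def matrix_vector_mult_def sum_distrib_left mult_ac)
      finally show ?thesis .
    qed
    have ineq: "Re (w * hermitian_form T v) \<le> Re (hermitian_form T v)" if w: "norm w = 1" for w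
    proof -
      define W where "W = mat 1 - mat_scale (1 - w) E"
      have "adj W ** W = mat 1 - mat_scale ((1 - w) + cnj (1 - w) - cnj (1 - w) * (1 - w)) E"
        by (simp add: W_def adj_diff adj_mat adj_mat_scale adjE matrix_diff_ldistrib
            matrix_diff_rdistrib mult_mat_scale mat_scale_mult EE)
          (simp add: mat_scale_def vec_eq_iff algebra_simps)
      also have "(1 - w) + cnj (1 - w) - cnj (1 - w) * (1 - w) = 0"
        using w complex_norm_square[of w] by (simp add: algebra_simps)
      finally have "adj W ** W = mat 1" by (simp add: mat_scale_def vec_eq_iff)
      moreover have "adj (W ** U) ** (W ** U) = adj U ** (adj W ** W) ** U"
        by (simp add: adj_mult matrix_mul_assoc)
      ultimately have "W ** U \<in> \<U>" using U by (simp add: \<U>_def)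
      then have "Re (trace (W ** T)) \<le> Re (trace T)"
        using max[of "W ** U"] by (simp add: T_def matrix_mul_assoc)
      moreover have "trace (W ** T) = trace T - (1 - w) * hermitian_form T v"
        by (simp add: W_def matrix_diff_rdistrib trace_sub mat_scale_mult flip: trE)
          (simp add: trace_def mat_scale_def sum_distrib_left)
      ultimately show ?thesis by (simp add: algebra_simps)
    qed
    show ?thesis
    proof (cases "hermitian_form T v = 0")
      case False
      \<comment> \<open>The factor \<open>w = cnj z / |z|\<close> rotates \<open>z\<close> to the positive real axis.\<close>
      define z where "z = hermitian_form T v"
      have "norm (cnj z / of_real (norm z)) = 1" using False by (simp add: z_def norm_divide)
      then have "Re (cnj z / of_real (norm z) * z) \<le> Re z"
        unfolding z_def by (rule ineq)
      moreover have "cnj z / of_real (norm z) * z = of_real (norm z)"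
        using False complex_norm_square[of z]
        by (simp add: z_def divide_simps power2_eq_square mult_ac)
      ultimately have "norm z \<le> Re z" by (metis Re_complex_of_real)
      then have "(norm z)\<^sup>2 \<le> (Re z)\<^sup>2" by (intro power_mono) auto
      then have "Im z = 0" by (simp add: cmod_power2)
      moreover have "0 \<le> Re z" using \<open>norm z \<le> Re z\<close> norm_ge_zero order_trans by blast
      ultimately show ?thesis by (simp add: complex_nonneg_Reals_iff z_def)
    qed simp
  qed
  then have "psd T" by (rule psd_if_hermitian_form_nonneg)
  moreover have "adj (adj U) ** adj U = mat 1"
    using U matrix_left_right_inverse by (auto simp: \<U>_def)
  moreover have "A = adj U ** T"
    using U by (simp add: T_def \<U>_def matrix_mul_assoc)
  ultimately show ?thesis by (intro that)
qed

definition matrix_abs :: "complex^'n^'n \<Rightarrow> complex^'n^'n" where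
  "matrix_abs A = (THE T. psd T \<and> T ** T = adj A ** A)"

lemma matrix_abs_eqI:
  assumes "psd T" "T ** T = adj A ** A"
  shows "matrix_abs A = T"
  unfolding matrix_abs_def
  by (rule the_equality) (use assms in \<open>auto intro: psd_sqrt_unique\<close>)

lemma psd_congruence:
  assumes "psd T"
  shows "psd (X ** T ** adj X)"
proof -
  have "adj (X ** T ** adj X) = X ** T ** adj X"
    using assms by (simp add: psd_def adj_mult matrix_mul_assoc)
  moreover have "0 \<le> v \<bullet> ((X ** T ** adj X) *v v)" for v
  proof -
    have "v \<bullet> ((X ** T ** adj X) *v v) = (adj X *v v) \<bullet> (T *v (adj X *v v))"
      by (simp add: inner_mult_vec[of "adj X"] matrix_vector_mul_assoc matrix_mul_assoc)
    then show ?thesis using assms by (simp add: psd_def)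
  qed
  ultimately show ?thesis by (simp add: psd_def)
qed

text \<open>
  Unlike \<open>U\<close>, the two absolute values are determined by \<open>A\<close>; the formula for \<open>|A\<^sup>*|\<close> is the reason why
  the deformation below can be written without \<open>U\<close>.
\<close>
lemma polar:
  obtains U where "adj U ** U = mat 1" "U ** adj U = mat 1" "A = U ** matrix_abs A"
    "matrix_abs (adj A) = U ** matrix_abs A ** adj U" "psd (matrix_abs A)"
proof -
  obtain U T where U: "adj U ** U = mat 1" and T: "psd T" and A: "A = U ** T"
    by (rule polar_decomposition)
  have "adj A ** A = T ** (adj U ** U) ** T"
    using T by (simp add: A adj_mult psd_def matrix_mul_assoc)
  then have mT: "matrix_abs A = T" using T U by (intro matrix_abs_eqI) auto
  have "(U ** T ** adj U) ** (U ** T ** adj U) = U ** T ** (adj U ** U) ** T ** adj U"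
    by (simp add: matrix_mul_assoc)
  also have "\<dots> = adj (adj A) ** adj A"
    using T U by (simp add: A adj_mult psd_def matrix_mul_assoc)
  finally have "matrix_abs (adj A) = U ** T ** adj U"
    using T by (intro matrix_abs_eqI psd_congruence)
  moreover have "U ** adj U = mat 1" using U matrix_left_right_inverse by auto
  ultimately show ?thesis using that U T A mT by metis
qed

lemma psd_matrix_abs: "psd (matrix_abs A)"
  by (rule polar)

lemma matrix_abs_square: "matrix_abs A ** matrix_abs A = adj A ** A"
proof -
  obtain U where U: "adj U ** U = mat 1" and A: "A = U ** matrix_abs A" by (rule polar)
  have "adj A ** A = adj (matrix_abs A) ** (adj U ** U) ** matrix_abs A"
    by (subst (1 2) A) (simp add: adj_mult matrix_mul_assoc)
  then show ?thesis using U psd_matrix_abs[of A] by (simp add: psd_def)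
qed

lemma matrix_abs_psd: "psd A \<Longrightarrow> matrix_abs A = A"
  by (rule matrix_abs_eqI) (simp_all add: psd_def)

lemma norm_matrix_abs: "norm (matrix_abs A) = norm A"
  using psd_matrix_abs[of A] by (simp add: norm_eq_sqrt_inner inner_eq_Re_trace matrix_abs_square psd_def)

text \<open>
  The Frobenius norms of \<open>A\<close> and \<open>|A|\<close> agree, so on a ball the map \<open>A \<mapsto> |A|\<close> has values in a compact
  set; its graph is closed because \<open>|A|\<close> is the only solution of closed conditions.
\<close>
lemma continuous_on_matrix_abs: "continuous_on S matrix_abs"
proof -
  have cball: "continuous_on (cball 0 r) (matrix_abs :: complex^'n^'n \<Rightarrow> _)" for r
  proof (rule continuous_from_closed_graph)
    show "matrix_abs \<in> cball 0 r \<rightarrow> cball (0 :: complex^'n^'n) r" by (simp add: norm_matrix_abs)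
    have "(\<lambda>A. (A, matrix_abs A)) ` cball 0 r =
        {z :: (complex^'n^'n) \<times> (complex^'n^'n). norm (fst z) \<le> r \<and> psd (snd z) \<and> snd z ** snd z = adj (fst z) ** fst z}"
      by (force simp: image_iff psd_matrix_abs matrix_abs_square dest: matrix_abs_eqI)
    moreover have "closed {z :: (complex^'n^'n) \<times> (complex^'n^'n). psd (snd z)}"
      using closed_vimage[OF closed_psd continuous_on_snd[OF continuous_on_id]]
      by (simp add: vimage_def)
    ultimately show "closed ((\<lambda>A :: complex^'n^'n. (A, matrix_abs A)) ` cball 0 r)"
      by (simp only:) (intro closed_Collect_conj closed_Collect_le closed_Collect_eq continuous_intros)
  qed simp
  have "isCont matrix_abs A" for A :: "complex^'n^'n"
    using continuous_on_interior[OF cball[of "norm A + 1"], of A] by simp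
  then show ?thesis by (auto intro: continuous_at_imp_continuous_on)
qed

lemma continuous_on_matrix_abs_compose [continuous_intros]:
  "continuous_on S f \<Longrightarrow> continuous_on S (\<lambda>x. matrix_abs (f x))"
  using continuous_on_compose2[OF continuous_on_matrix_abs[of UNIV]] by auto

section \<open>Deforming a degenerate matrix to a positive semidefinite one\<close>

text \<open>
  The path \<open>(U + t) |A| (1 + t U\<^sup>*)\<close>, expanded so that it does not mention the unitary factor \<open>U\<close>,
  which is not unique, and cannot be chosen continuously, where \<open>A\<close> is degenerate.
\<close>
definition bend :: "real \<Rightarrow> complex^'n^'n \<Rightarrow> complex^'n^'n" where
  "bend t A = A + t\<^sup>2 *\<^sub>R adj A + t *\<^sub>R (matrix_abs A + matrix_abs (adj A))"

lemma bend_0: "bend 0 A = A"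
  by (simp add: bend_def)

lemma bend_factorization:
  obtains U where "adj U ** U = mat 1" "A = U ** matrix_abs A"
    "\<And>t. bend t A = (U + mat (of_real t)) ** matrix_abs A ** adj (mat 1 + t *\<^sub>R U)"
proof -
  obtain U where U: "adj U ** U = mat 1" "A = U ** matrix_abs A"
    "matrix_abs (adj A) = U ** matrix_abs A ** adj U" "psd (matrix_abs A)"
    by (rule polar)
  define T where "T = matrix_abs A"
  have A: "A = U ** T" and adjA: "adj A = T ** adj U"
    using U(2,4) adj_mult[of U T] by (auto simp: T_def psd_def)
  have "bend t A = U ** T + t\<^sup>2 *\<^sub>R (T ** adj U) + t *\<^sub>R (T + U ** T ** adj U)" for t
    unfolding bend_def U(3) unfolding T_def[symmetric] adjA using A by simp
  then have "bend t A = (U + mat (of_real t)) ** matrix_abs A ** adj (mat 1 + t *\<^sub>R U)" for t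
    unfolding T_def[symmetric] by (simp add: adj_add adj_mat adj_scaleR matrix_add_ldistrib
        matrix_add_rdistrib mult_scaleR scaleR_mult mat_eq_mat_scale[of "of_real t"] mat_scale_of_real
        algebra_simps power2_eq_square)
  then show ?thesis using that U by blast
qed

lemma det_bend:
  assumes "det A = 0"
  shows "det (bend t A) = 0"
proof -
  obtain U where U: "adj U ** U = mat 1" "A = U ** matrix_abs A"
    and bend: "bend t A = (U + mat (of_real t)) ** matrix_abs A ** adj (mat 1 + t *\<^sub>R U)"
    using bend_factorization[of A] by blast
  have "det (adj U) * det U = 1" using U(1) by (metis det_I det_mul)
  then have "det U \<noteq> 0" by auto
  then have "det (matrix_abs A) = 0" using assms U(2) by (metis det_mul mult_eq_0_iff)
  then show ?thesis by (simp add: bend det_mul)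
qed

lemma psd_bend_1: "psd (bend 1 A)"
proof -
  obtain U where "bend 1 A = (U + mat (of_real 1)) ** matrix_abs A ** adj (mat 1 + 1 *\<^sub>R U)"
    using bend_factorization[of A] by blast
  then have eq: "bend 1 A = (U + mat 1) ** matrix_abs A ** adj (U + mat 1)" by (simp add: add.commute)
  show ?thesis unfolding eq by (intro psd_congruence psd_matrix_abs)
qed

text \<open>
  Here \<open>U\<close> may be taken to be the identity.
\<close>
lemma bend_psd:
  assumes "psd A"
  shows "bend t A = (1 + t)\<^sup>2 *\<^sub>R A"
proof -
  have "bend t A = A + t\<^sup>2 *\<^sub>R A + t *\<^sub>R (A + A)"
    using assms matrix_abs_psd[of A] by (simp add: bend_def psd_def)
  then show ?thesis
    by (simp add: vec_eq_iff power2_sum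
      scaleR_conv_of_real[where 'a = complex] algebra_simps)
qed

lemma trace_psd:
  assumes "psd T"
  obtains c where "trace T = of_real c" "c \<ge> 0"
proof -
  have "trace T = cnj (trace T)" using assms trace_adj[of T] by (simp add: psd_def)
  then have "Im (trace T) = 0" by (simp add: complex_eq_iff)
  moreover have "Re (T $ i $ i) = axis i 1 \<bullet> (T *v axis i 1)" for i
    by (simp add: inner_axis' inner_complex_def) (simp add: matrix_vector_mult_def axis_def
        if_distrib cong: if_cong)
  then have "0 \<le> Re (trace T)"
    using assms by (auto simp: trace_def psd_def intro!: sum_nonneg)
  ultimately show ?thesis using that[of "Re (trace T)"] by (simp add: complex_eq_iff)
qed

lemma trace_bend:
  assumes "trace A = of_real r"
  shows "\<exists>c\<ge>0. \<forall>t. trace (bend t A) = of_real (r * (1 + t\<^sup>2) + 2 * t * c)"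
proof -
  obtain U where U: "adj U ** U = mat 1" "matrix_abs (adj A) = U ** matrix_abs A ** adj U"
    by (rule polar)
  obtain c where c: "trace (matrix_abs A) = of_real c" "c \<ge> 0"
    using psd_matrix_abs by (rule trace_psd)
  have "trace (matrix_abs (adj A)) = trace (adj U ** (U ** matrix_abs A))"
    unfolding U(2) by (rule trace_mul_sym)
  then have "trace (matrix_abs (adj A)) = of_real c" using U(1) c by (simp add: matrix_mul_assoc)
  then have "trace (bend t A) = of_real (r * (1 + t\<^sup>2) + 2 * t * c)" for t
    using assms c by (simp add: bend_def trace_add trace_scaleR trace_adj)
      (simp add: scaleR_conv_of_real[where 'a = complex] algebra_simps)
  then show ?thesis using c(2) by blast
qed

text \<open>
  The last assumption is what the path \<open>bend\<close> needs to stay in \<open>V\<close>.  It asks for the sum only: for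
  symmetric matrices \<open>|A|\<close> need not be symmetric, since transposition exchanges \<open>|A|\<close> and \<open>|A\<^sup>*|\<close>.
\<close>
locale star_space =
  fixes V :: "(complex^'n^'n) set"
  assumes add_mem: "A \<in> V \<Longrightarrow> B \<in> V \<Longrightarrow> A + B \<in> V"
    and mat_scale_mem: "A \<in> V \<Longrightarrow> mat_scale c A \<in> V"
    and one_mem: "mat 1 \<in> V"
    and adj_mem: "A \<in> V \<Longrightarrow> adj A \<in> V"
    and matrix_abs_mem: "A \<in> V \<Longrightarrow> matrix_abs A + matrix_abs (adj A) \<in> V"
begin

lemma scaleR_mem: "A \<in> V \<Longrightarrow> c *\<^sub>R A \<in> V"
  using mat_scale_mem[of A "of_real c"] by (simp add: mat_scale_of_real)

lemma bend_mem: "A \<in> V \<Longrightarrow> bend t A \<in> V"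
  unfolding bend_def by (intro add_mem scaleR_mem adj_mem matrix_abs_mem)

text \<open>
  The path \<open>bend\<close>, rescaled to constant trace, is a strong deformation retraction.
\<close>
lemma psd_link_homotopy_equivalence:
  assumes r: "r > 0"
  defines "L \<equiv> complex_link V trace (of_real r)"
  shows "homotopy_equivalence_map (top_of_set {A \<in> L. psd A}) (top_of_set L) id"
proof -
  define S where "S = {A \<in> L. psd A}"
  define h where "h = (\<lambda>t (A :: complex^'n^'n). (r / Re (trace (bend t A))) *\<^sub>R bend t A)"
  have L: "A \<in> L \<longleftrightarrow> A \<in> V \<and> det A = 0 \<and> trace A = of_real r" for A
    by (auto simp: L_def complex_link_def degenerate_def)
  have pos: "\<exists>x>0. trace (bend t A) = of_real x" if "A \<in> L" "t \<ge> 0" for t A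
  proof -
    have "trace A = of_real r" using that by (simp add: L)
    then obtain c where c: "c \<ge> 0" "\<And>t. trace (bend t A) = of_real (r * (1 + t\<^sup>2) + 2 * t * c)"
      using trace_bend by blast
    have "r * (1 + t\<^sup>2) > 0" using r by (intro mult_pos_pos) (auto intro: add_pos_nonneg)
    moreover have "2 * t * c \<ge> 0" using c that by simp
    ultimately show ?thesis using c(2) by (meson add_pos_nonneg)
  qed
  have h_mem: "h t A \<in> L" if A: "A \<in> L" and t: "t \<ge> 0" for t A
  proof -
    obtain x where x: "x > 0" "trace (bend t A) = of_real x" using pos[OF A t] by blast
    have "h t A \<in> V" using A by (simp add: h_def L scaleR_mem bend_mem)
    moreover have "det (h t A) = 0"
    proof -
      obtain v where "v \<noteq> 0" "bend t A *v v = 0"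
        using A det_bend det_eq_0_iff_kernel by (metis L)
      then show ?thesis by (auto simp: det_eq_0_iff_kernel h_def scaleR_mult_vec)
    qed
    moreover have "trace (h t A) = of_real r"
      using x by (simp add: h_def trace_scaleR scaleR_conv_of_real[where 'a = complex])
    ultimately show ?thesis by (simp add: L)
  qed
  have h0: "h 0 A = A" if "A \<in> L" for A
    using that r by (simp add: h_def bend_0 L)
  have h1: "h 1 A \<in> S" if A: "A \<in> L" for A
  proof -
    obtain x where x: "x > 0" "trace (bend 1 A) = of_real x" using pos[OF A, of 1] by auto
    have "psd (h 1 A)"
      using psd_bend_1[of A] x r by (simp add: h_def psd_def adj_scaleR scaleR_mult_vec)
    then show ?thesis using h_mem[OF A, of 1] by (simp add: S_def)
  qed
  have hS: "h t A = A" if "A \<in> S" "t \<ge> 0" for t A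
  proof -
    have "(1 + t)\<^sup>2 \<noteq> 0" using that by simp
    then show ?thesis
      using that r by (simp add: S_def L h_def bend_psd trace_scaleR)
  qed
  have cont: "continuous_on ({0..1::real} \<times> L) (\<lambda>z. h (fst z) (snd z))"
    unfolding h_def bend_def
  proof (intro continuous_intros ballI)
    fix z :: "real \<times> (complex^'n^'n)" assume "z \<in> {0..1} \<times> L"
    then have "Re (trace (bend (fst z) (snd z))) \<noteq> 0" using pos[of "snd z" "fst z"] by auto
    then show "Re (trace (snd z + (fst z)\<^sup>2 *\<^sub>R adj (snd z) +
        fst z *\<^sub>R (matrix_abs (snd z) + matrix_abs (adj (snd z))))) \<noteq> 0" by (simp add: bend_def)
  qed
  have SL: "S \<subseteq> L" by (auto simp: S_def)
  have h1_cont: "continuous_map (top_of_set L) (top_of_set S) (h 1)"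
  proof -
    have "continuous_on L (\<lambda>A. (\<lambda>z. h (fst z) (snd z)) (1, A))"
      by (rule continuous_on_compose2[OF cont]) (auto intro!: continuous_intros)
    then show ?thesis using h1 by auto
  qed
  have "homotopic_with (\<lambda>h. True) (top_of_set L) (top_of_set L) id (id \<circ> h 1)"
  proof -
    have "continuous_map (prod_topology (top_of_set {0..1}) (top_of_set L)) (top_of_set L)
        (\<lambda>z. h (fst z) (snd z))"
      using cont h_mem by (auto simp flip: subtopology_Times)
    then show ?thesis
      by (subst homotopic_with) (auto intro!: exI[of _ "\<lambda>z. h (fst z) (snd z)"] h0)
  qed
  then have "homotopic_with (\<lambda>h. True) (top_of_set L) (top_of_set L) (id \<circ> h 1) id"
    by (rule homotopic_with_symD)
  moreover have "homotopic_with (\<lambda>h. True) (top_of_set S) (top_of_set S) (h 1 \<circ> id) id"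
    using hS by (intro homotopic_with_equal) (auto simp: continuous_map_from_subtopology)
  ultimately show ?thesis
    using SL h1_cont unfolding homotopy_equivalence_map_def S_def[symmetric]
    by (auto intro!: exI[of _ "h 1"])
qed

end

section \<open>The boundary of the body of positive semidefinite matrices of fixed trace\<close>

text \<open>
  A positive definite Hermitian matrix is an interior point of the positive semidefinite cone.
\<close>
lemma psd_perturb:
  fixes M X :: "complex^'n^'n"
  assumes "adj M = M" "adj X = X" "m > 0" "\<And>w. m * (w \<bullet> w) \<le> w \<bullet> (M *v w)"
  obtains e where "e > 0" "psd (M + e *\<^sub>R X)"
proof -
  have "linear (\<lambda>w. X *v w)"
    by (rule linearI) (simp_all add: mult_vec_scaleR matrix_vector_right_distrib)
  then obtain b where b: "b > 0" "\<And>w. norm (X *v w) \<le> b * norm w"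
    using linear_bounded_pos by blast
  define e where "e = m / b"
  have "0 \<le> w \<bullet> ((M + e *\<^sub>R X) *v w)" for w
  proof -
    have "- (b * (w \<bullet> w)) \<le> w \<bullet> (X *v w)"
    proof -
      have "\<bar>w \<bullet> (X *v w)\<bar> \<le> norm w * norm (X *v w)" by (rule Cauchy_Schwarz_ineq2)
      also have "\<dots> \<le> norm w * (b * norm w)" by (intro mult_left_mono b) simp
      also have "\<dots> = b * (w \<bullet> w)" by (simp add: dot_square_norm power2_eq_square)
      finally show ?thesis by simp
    qed
    then have "e * - (b * (w \<bullet> w)) \<le> e * (w \<bullet> (X *v w))"
      using b assms(3) by (intro mult_left_mono) (simp_all add: e_def)
    moreover have "e * - (b * (w \<bullet> w)) = - (m * (w \<bullet> w))" using b by (simp add: e_def)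
    ultimately have "0 \<le> w \<bullet> (M *v w) + e * (w \<bullet> (X *v w))"
      using assms(4)[of w] by linarith
    then show ?thesis
      by (simp add: matrix_vector_mult_add_rdistrib scaleR_mult_vec inner_add_right)
  qed
  then have "psd (M + e *\<^sub>R X)" using assms by (simp add: psd_def adj_add adj_scaleR)
  moreover have "e > 0" using b assms by (simp add: e_def)
  ultimately show ?thesis using that by blast
qed

text \<open>
  Expand the form of \<open>A\<close> at \<open>v + w\<close> and at \<open>v - w\<close>.
\<close>
lemma psd_polarization_bound:
  assumes "psd A"
  shows "2 * \<bar>v \<bullet> (A *v w)\<bar> \<le> v \<bullet> (A *v v) + w \<bullet> (A *v w)"
proof -
  have sym: "w \<bullet> (A *v v) = v \<bullet> (A *v w)"
    using assms inner_mult_vec[of A v w] by (simp add: psd_def inner_commute)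
  have "0 \<le> (v + w) \<bullet> (A *v (v + w))" "0 \<le> (v - w) \<bullet> (A *v (v - w))"
    using assms by (auto simp: psd_def)
  then show ?thesis
    by (simp add: matrix_vector_right_distrib matrix_vector_mult_diff_distrib inner_add_left
        inner_add_right inner_diff_left inner_diff_right sym)
qed

text \<open>
  The polarization bound at coordinate vectors bounds each entry by two diagonal entries, and these
  are nonnegative with sum the trace.  Only some bound in terms of the trace matters.
\<close>
lemma norm_psd_le_trace:
  fixes A :: "complex^'n^'n"
  assumes "psd A"
  shows "norm A \<le> (\<Sum>i\<in>(UNIV :: 'n set). \<Sum>j\<in>(UNIV :: 'n set). 2 * Re (trace A))"
proof -
  have mult_axis: "(A *v axis j c) $ i = A $ i $ j * c" for i j c
    by (simp add: matrix_vector_mult_def axis_def if_distrib cong: if_cong)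
  have form: "axis i c \<bullet> (A *v axis j d) = Re (cnj c * (A $ i $ j * d))" for i j c d
    by (simp add: inner_axis' inner_complex_def mult_axis)
  have diag_nonneg: "0 \<le> Re (A $ i $ i)" for i
    using assms form[of i 1 i 1] by (metis psd_def complex_cnj_one mult_1 mult_1_right)
  have diag: "Re (A $ i $ i) \<le> Re (trace A)" for i
    unfolding trace_def Re_sum using diag_nonneg by (intro member_le_sum) auto
  have "2 * \<bar>Re (A $ i $ j)\<bar> \<le> Re (A $ i $ i) + Re (A $ j $ j)" for i j
    using psd_polarization_bound[OF assms, of "axis i 1" "axis j 1"] by (simp add: form)
  moreover have "2 * \<bar>Im (A $ i $ j)\<bar> \<le> Re (A $ i $ i) + Re (A $ j $ j)" for i j
    using psd_polarization_bound[OF assms, of "axis i \<i>" "axis j 1"] by (simp add: form)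
  ultimately have entry: "norm (A $ i $ j) \<le> 2 * Re (trace A)" for i j
    using cmod_le[of "A $ i $ j"] diag[of i] diag[of j] by (smt (verit))
  have "norm A \<le> (\<Sum>i\<in>UNIV. norm (A $ i))"
    unfolding norm_vec_def[of A] by (rule L2_set_le_sum) simp
  also have "\<dots> \<le> (\<Sum>i\<in>UNIV. \<Sum>j\<in>UNIV. norm (A $ i $ j))"
    unfolding norm_vec_def[of "_ $ _"] by (intro sum_mono L2_set_le_sum) simp
  also have "\<dots> \<le> (\<Sum>i\<in>(UNIV :: 'n set). \<Sum>j\<in>(UNIV :: 'n set). 2 * Re (trace A))"
    by (intro sum_mono entry)
  finally show ?thesis .
qed

interpretation cmat: vector_space "mat_scale :: complex \<Rightarrow> complex^'m^'n \<Rightarrow> complex^'m^'n"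
  by (rule vector_space_mat_scale)

context star_space
begin

definition hermitian_part :: "(complex^'n^'n) set" where
  "hermitian_part = {A \<in> V. adj A = A}"

lemma zero_mem: "0 \<in> V"
  using scaleR_mem[OF one_mem, of 0] by simp

lemma subspace_herm: "subspace hermitian_part"
  by (auto simp: subspace_def hermitian_part_def zero_mem add_mem scaleR_mem adj_add adj_scaleR)
    (simp add: adj_def vec_eq_iff)

lemma closed_V: "closed V"
  by (rule closed_subspace) (simp add: subspace_def zero_mem add_mem scaleR_mem)

text \<open>
  Since \<open>A = X + \<i> Y\<close> with \<open>X\<close> and \<open>Y\<close> Hermitian in a unique way, \<open>V\<close> is the complexification of its
  Hermitian part, and a real basis of the latter is a complex basis of \<open>V\<close>.
\<close>
lemma cdim_eq_dim_herm: "cdim V = dim hermitian_part"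
proof -
  obtain B where B: "B \<subseteq> hermitian_part" "independent B" "hermitian_part \<subseteq> span B" "card B = dim hermitian_part"
    by (rule basis_exists)
  have "V \<subseteq> cmat.span B"
  proof
    fix A assume A: "A \<in> V"
    have "subspace (cmat.span B)"
      by (auto simp: subspace_def cmat.span_zero cmat.span_add simp flip: mat_scale_of_real
          intro: cmat.span_scale)
    then have hermitian_part: "hermitian_part \<subseteq> cmat.span B"
      using B(3) span_minimal[OF cmat.span_superset] by blast
    define X where "X = (1/2) *\<^sub>R (A + adj A)"
    define Y where "Y = mat_scale (- \<i> / 2) (A + mat_scale (-1) (adj A))"
    have "X \<in> V" "Y \<in> V"
      unfolding X_def Y_def by (intro scaleR_mem mat_scale_mem add_mem adj_mem A)+
    moreover have "adj X = X" "adj Y = Y"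
      by (simp_all add: X_def Y_def adj_def mat_scale_def vec_eq_iff field_simps)
    ultimately have "X \<in> hermitian_part" "Y \<in> hermitian_part" by (simp_all add: hermitian_part_def)
    then have "X + mat_scale \<i> Y \<in> cmat.span B"
      using hermitian_part by (intro cmat.span_add cmat.span_scale) auto
    moreover have "A = X + mat_scale \<i> Y"
      by (simp add: X_def Y_def mat_scale_def vec_eq_iff scaleR_conv_of_real[where 'a = complex] field_simps)
    ultimately show "A \<in> cmat.span B"
      by (rule ssubst[rotated])
  qed
  moreover have "cmat.independent B"
    unfolding cmat.independent_explicit_finite_subsets
  proof (intro allI impI ballI)
    fix T u b assume T: "T \<subseteq> B" "finite T" and sum0: "(\<Sum>v\<in>T. mat_scale (u v) v) = 0" and b: "b \<in> T"
    have entry: "(\<Sum>v\<in>T. u v * v $ i $ j) = 0" for i j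
      using arg_cong[OF sum0, of "\<lambda>M. M $ i $ j"] by (simp add: mat_scale_def)
    have hermitian_part: "cnj (v $ j $ i) = v $ i $ j" if "v \<in> T" for v i j
      using that T B(1) by (auto simp: hermitian_part_def adj_def vec_eq_iff)
    have entry': "(\<Sum>v\<in>T. cnj (u v) * v $ i $ j) = 0" for i j
      using arg_cong[OF entry[of j i], of cnj] hermitian_part by (simp add: cong: sum.cong)
    have "(\<Sum>v\<in>T. Re (u v) *\<^sub>R v) = 0"
    proof -
      have "2 * (\<Sum>v\<in>T. Re (u v) *\<^sub>R v) $ i $ j
          = (\<Sum>v\<in>T. u v * v $ i $ j + cnj (u v) * v $ i $ j)" for i j
        unfolding sum_component sum_distrib_left
        by (intro sum.cong refl) (simp add: complex_eq_iff)
      then show ?thesis by (simp add: vec_eq_iff sum.distrib entry entry')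
    qed
    then have "Re (u b) = 0" by (rule independentD[OF B(2) T(2,1) _ b])
    moreover have "(\<Sum>v\<in>T. Im (u v) *\<^sub>R v) = 0"
    proof -
      have "2 * \<i> * (\<Sum>v\<in>T. Im (u v) *\<^sub>R v) $ i $ j
          = (\<Sum>v\<in>T. u v * v $ i $ j - cnj (u v) * v $ i $ j)" for i j
        unfolding sum_component sum_distrib_left
        by (intro sum.cong refl) (simp add: complex_eq_iff)
      then show ?thesis by (simp add: vec_eq_iff sum_subtractf entry entry')
    qed
    then have "Im (u b) = 0" by (rule independentD[OF B(2) T(2,1) _ b])
    ultimately show "u b = 0" by (simp add: complex_eq_iff)
  qed
  ultimately have "cmat.dim V = card B"
    using B(1) by (intro cmat.dim_unique) (auto simp: hermitian_part_def)
  then show ?thesis by (simp add: cdim_def B(4))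
qed

text \<open>
  Up to the factor \<open>r\<close>, the density matrices of quantum mechanics that lie in \<open>V\<close>.
\<close>
definition density :: "real \<Rightarrow> (complex^'n^'n) set" where
  "density r = {A \<in> V. psd A \<and> trace A = of_real r}"

lemma density_subset_herm: "density r \<subseteq> hermitian_part \<inter> {A. mat 1 \<bullet> A = r}"
  by (auto simp: density_def hermitian_part_def psd_def inner_eq_Re_trace adj_mat)

lemma trace_herm: "A \<in> hermitian_part \<Longrightarrow> mat 1 \<bullet> A = r \<Longrightarrow> trace A = of_real r"
  using trace_adj[of A] by (simp add: hermitian_part_def inner_eq_Re_trace adj_mat complex_eq_iff)

lemma convex_density: "convex (density r)"
  unfolding convex_def density_def psd_def
  by (auto simp: add_mem scaleR_mem adj_add adj_scaleR trace_add trace_scaleR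
      matrix_vector_mult_add_rdistrib scaleR_mult_vec inner_add_right
      simp flip: scaleR_left_distrib)

lemma bounded_density: "bounded (density r)"
  unfolding bounded_iff using norm_psd_le_trace by (force simp: density_def)

lemma closed_density: "closed (density r)"
proof -
  have "closed {A :: complex^'n^'n. trace A = of_real r}"
    by (intro closed_Collect_eq continuous_intros)
  then have "closed (V \<inter> {A. psd A} \<inter> {A. trace A = of_real r})"
    using closed_V closed_psd by (intro closed_Int)
  moreover have "density r = V \<inter> {A. psd A} \<inter> {A. trace A = of_real r}" by (auto simp: density_def)
  ultimately show ?thesis by simp
qed

definition centre :: "real \<Rightarrow> complex^'n^'n" where
  "centre r = (r / real CARD('n)) *\<^sub>R mat 1"

lemma inner_centre: "w \<bullet> (centre r *v w) = r / real CARD('n) * (w \<bullet> w)"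
  by (simp add: centre_def scaleR_mult_vec)

lemma centre_density: "r > 0 \<Longrightarrow> centre r \<in> density r"
  using inner_centre[of _ r]
  by (simp add: density_def psd_def)
    (simp add: centre_def scaleR_mem one_mem adj_scaleR adj_mat trace_scaleR trace_I
      scaleR_conv_of_real[where 'a = complex])

text \<open>
  The multiple of the identity with trace \<open>r\<close> is positive definite, hence every Hermitian
  matrix of trace \<open>r\<close> lies on a line through it and another point of the body.
\<close>
lemma affine_hull_density:
  assumes r: "r > 0"
  shows "affine hull (density r) = hermitian_part \<inter> {A. mat 1 \<bullet> A = r}"
proof
  have "affine (hermitian_part \<inter> {A. mat 1 \<bullet> A = r})"
    by (intro affine_Int affine_hyperplane subspace_imp_affine subspace_herm)
  then show "affine hull (density r) \<subseteq> hermitian_part \<inter> {A. mat 1 \<bullet> A = r}"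
    using density_subset_herm by (rule hull_minimal[rotated])
next
  show "hermitian_part \<inter> {A. mat 1 \<bullet> A = r} \<subseteq> affine hull (density r)"
  proof
    fix A assume A: "A \<in> hermitian_part \<inter> {A. mat 1 \<bullet> A = r}"
    have c: "centre r \<in> hermitian_part" "mat 1 \<bullet> centre r = r"
      using centre_density[OF r] density_subset_herm by auto
    obtain e where e: "e > 0" "psd (centre r + e *\<^sub>R (A - centre r))"
    proof (rule psd_perturb[of "centre r" "A - centre r" "r / real CARD('n)"])
      show "adj (centre r) = centre r" "adj (A - centre r) = A - centre r"
        using A c by (auto simp: hermitian_part_def adj_diff)
    qed (use r in \<open>auto simp: inner_centre\<close>)
    define D where "D = centre r + e *\<^sub>R (A - centre r)"
    have "D \<in> hermitian_part" unfolding D_def using A c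
      by (intro subspace_add subspace_scale subspace_diff subspace_herm) auto
    moreover have "mat 1 \<bullet> D = r"
      using A c by (simp add: D_def inner_add_right inner_diff_right)
    ultimately have "D \<in> density r" using e trace_herm by (auto simp: density_def hermitian_part_def D_def)
    then have "(1 / e) *\<^sub>R D + (1 - 1 / e) *\<^sub>R centre r \<in> affine hull (density r)"
      using centre_density[OF r] by (intro mem_affine[OF affine_affine_hull] hull_inc) auto
    moreover have "(1 / e) *\<^sub>R D + (1 - 1 / e) *\<^sub>R centre r = A"
      using e by (simp add: D_def algebra_simps)
    ultimately show "A \<in> affine hull (density r)" by simp
  qed
qed

lemma aff_dim_density:
  assumes r: "r > 0"
  shows "aff_dim (density r) = int (cdim V) - 1"
proof -
  have "hermitian_part \<inter> {A. mat 1 \<bullet> A = r} \<noteq> {}"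
    using centre_density[OF r] density_subset_herm by blast
  moreover have "\<not> hermitian_part \<subseteq> {A. mat 1 \<bullet> A = r}"
    using r subspace_0[OF subspace_herm] by auto
  ultimately have "aff_dim (hermitian_part \<inter> {A. mat 1 \<bullet> A = r}) = aff_dim hermitian_part - 1"
    by (simp add: aff_dim_affine_Int_hyperplane subspace_imp_affine subspace_herm)
  then show ?thesis
    using affine_hull_density[OF r] aff_dim_affine_hull[of "density r"]
    by (simp add: aff_dim_subspace subspace_herm cdim_eq_dim_herm)
qed

text \<open>
  A nondegenerate member is positive definite, so the body extends beyond it on every segment.  At a
  degenerate member the segment from the centre cannot be extended, because the form at a kernel
  vector would become negative.
\<close>
lemma rel_frontier_density:
  assumes r: "r > 0"
  shows "rel_frontier (density r) = {A \<in> density r. det A = 0}"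
proof -
  have iff: "A \<in> rel_interior (density r) \<longleftrightarrow>
      (\<forall>X\<in>density r. \<exists>e. e > 1 \<and> (1 - e) *\<^sub>R X + e *\<^sub>R A \<in> density r)" for A
    by (rule convex_rel_interior_iff[OF convex_density]) (use centre_density[OF r] in auto)
  have "A \<notin> rel_interior (density r)" if A: "A \<in> density r" "det A = 0" for A
  proof
    assume "A \<in> rel_interior (density r)"
    then obtain e where e: "e > 1" "(1 - e) *\<^sub>R centre r + e *\<^sub>R A \<in> density r"
      using iff centre_density[OF r] by blast
    obtain v where v: "v \<noteq> 0" "A *v v = 0" using A(2) det_eq_0_iff_kernel by blast
    have "0 \<le> v \<bullet> (((1 - e) *\<^sub>R centre r + e *\<^sub>R A) *v v)"
      using e(2) by (simp add: density_def psd_def)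
    also have "\<dots> = (1 - e) * (r / real CARD('n) * (v \<bullet> v))"
      by (simp add: matrix_vector_mult_add_rdistrib scaleR_mult_vec v inner_centre)
    also have "\<dots> < 0"
      using e r v inner_gt_zero_iff[of v] by (intro mult_neg_pos mult_pos_pos) auto
    finally show False by simp
  qed
  moreover have "A \<in> rel_interior (density r)" if A: "A \<in> density r" "det A \<noteq> 0" for A
    unfolding iff
  proof
    fix X assume X: "X \<in> density r"
    have hA: "adj A = A" "psd A" and hX: "adj X = X" using A X by (auto simp: density_def psd_def)
    obtain v m where v: "v \<noteq> 0" "A *v v = m *\<^sub>R v" "\<And>w. m * (w \<bullet> w) \<le> w \<bullet> (A *v w)"
      using hermitian_least_eigenvalue[OF hA(1)] by blast
    have "m \<noteq> 0" using v(1,2) A(2) det_eq_0_iff_kernel[of A] by fastforce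
    moreover have "0 \<le> m * (v \<bullet> v)" using hA(2) v(2) by (metis inner_scaleR_right psd_def)
    then have "m \<ge> 0" using v(1) inner_gt_zero_iff[of v] by (meson not_le zero_le_mult_iff)
    ultimately have "m > 0" by simp
    then obtain e where e: "e > 0" "psd (A + e *\<^sub>R (A - X))"
      using psd_perturb[OF hA(1) _ _ v(3), of "A - X"] hA hX by (auto simp: adj_diff)
    have eq: "(1 - (1 + e)) *\<^sub>R X + (1 + e) *\<^sub>R A = A + e *\<^sub>R (A - X)" by (simp add: algebra_simps)
    have mem: "A + e *\<^sub>R (A - X) \<in> hermitian_part"
      using A(1) X density_subset_herm
      by (intro subspace_add subspace_scale subspace_diff subspace_herm) auto
    moreover have "mat 1 \<bullet> (A + e *\<^sub>R (A - X)) = r"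
    proof -
      have "mat 1 \<bullet> A = r" "mat 1 \<bullet> X = r" using A(1) X density_subset_herm[of r] by auto
      then show ?thesis by (simp add: inner_add_right inner_diff_right)
    qed
    ultimately have "A + e *\<^sub>R (A - X) \<in> density r"
      using e trace_herm by (auto simp: density_def hermitian_part_def)
    then have "(1 - (1 + e)) *\<^sub>R X + (1 + e) *\<^sub>R A \<in> density r" by (simp only: eq)
    moreover have "1 + e > 1" using e(1) by simp
    ultimately show "\<exists>e. e > 1 \<and> (1 - e) *\<^sub>R X + e *\<^sub>R A \<in> density r" by blast
  qed
  ultimately show ?thesis
    using closed_density[of r] rel_interior_subset[of "density r"] by (auto simp: rel_frontier_def)
qed

end

lemma homeomorphic_imp_homeomorphic_space:
  assumes "S homeomorphic T"
  shows "top_of_set S homeomorphic_space top_of_set T"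
proof -
  obtain f g where "homeomorphism S T f g" using assms by (auto simp: homeomorphic_def)
  then have "homeomorphic_maps (top_of_set S) (top_of_set T) f g"
    by (auto simp: homeomorphism_def homeomorphic_maps_def)
  then show ?thesis by (auto simp: homeomorphic_space_def)
qed

text \<open>
  For the zero subspace both sides are empty: \<open>sphere_space (-1)\<close> is the empty space.
\<close>
lemma unit_sphere_subspace_homeomorphic:
  fixes T :: "'a::euclidean_space set"
  assumes "subspace T"
  shows "top_of_set (sphere 0 1 \<inter> T) homeomorphic_space sphere_space (int (dim T) - 1)"
proof (cases "dim T = 0")
  case True
  then have "sphere 0 1 \<inter> T = {}" using dim_eq_0[of T] by (auto simp: dist_norm)
  then show ?thesis using True by (simp add: sphere_space_def homeomorphic_empty_space_eq)
next
  case False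
  obtain B where B: "B \<subseteq> T" "pairwise orthogonal B" "\<And>x. x \<in> B \<Longrightarrow> norm x = 1"
    "independent B" "card B = dim T" "span B = T"
    using orthonormal_basis_subspace[OF assms] by metis
  obtain f :: "(nat \<Rightarrow> real) \<Rightarrow> 'a" and g
    where "homeomorphic_maps (nsphere (dim T - 1)) (top_of_set (sphere 0 1 \<inter> span B)) f g"
    using homeomorphic_maps_nsphere_euclidean_sphere[OF B(4,2,5) False B(3)] by blast
  then have "nsphere (dim T - 1) homeomorphic_space top_of_set (sphere 0 1 \<inter> T)"
    using B(6) homeomorphic_space_def by blast
  moreover have "sphere_space (int (dim T) - 1) = nsphere (dim T - 1)"
    using False by (simp add: sphere_space_def nat_diff_distrib')
  ultimately show ?thesis using homeomorphic_space_sym by metis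
qed

lemma rel_frontier_homeomorphic_sphere:
  fixes C :: "'a::euclidean_space set"
  assumes "bounded C" "convex C" "C \<noteq> {}"
  shows "top_of_set (rel_frontier C) homeomorphic_space sphere_space (aff_dim C - 1)"
proof -
  have "aff_dim C \<le> int (dim (UNIV :: 'a set))" using aff_dim_le_DIM[of C] by simp
  then obtain T :: "'a set" where T: "subspace T" "aff_dim T = aff_dim C" "rel_frontier C homeomorphic sphere 0 1 \<inter> T"
    using spheremap_lemma3[OF assms(1,2) subspace_UNIV] assms(3) by metis
  have "int (dim T) = aff_dim C" using T by (simp add: aff_dim_subspace)
  then show ?thesis
    using homeomorphic_imp_homeomorphic_space[OF T(3)] unit_sphere_subspace_homeomorphic[OF T(1)]
      homeomorphic_space_trans by metis
qed

theorem (in star_space) sphere_in_complex_link: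
  assumes r: "r > 0"
  shows "sphere_may_be_taken (complex_link V trace (of_real r)) (int (cdim V) - 2)
    {A \<in> complex_link V trace (of_real r). psd A}"
proof -
  have S: "{A \<in> complex_link V trace (of_real r). psd A} = rel_frontier (density r)"
    unfolding rel_frontier_density[OF r] by (auto simp: complex_link_def degenerate_def density_def)
  have "top_of_set (rel_frontier (density r)) homeomorphic_space sphere_space (aff_dim (density r) - 1)"
    using centre_density[OF r] by (intro rel_frontier_homeomorphic_sphere bounded_density convex_density) auto
  then have "top_of_set (rel_frontier (density r)) homeomorphic_space sphere_space (int (cdim V) - 2)"
    by (simp add: aff_dim_density[OF r])
  then show ?thesis
    using psd_link_homotopy_equivalence[OF r] S unfolding sphere_may_be_taken_def by auto
qed

section \<open>Complex links for an arbitrary non-zero trace\<close>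

lemma homotopy_equivalent_space_if_sphere_may_be_taken:
  assumes "sphere_may_be_taken L d S"
  shows "top_of_set L homotopy_equivalent_space sphere_space d"
proof -
  have "top_of_set S homotopy_equivalent_space top_of_set L"
    using assms unfolding sphere_may_be_taken_def homotopy_equivalence_map_def
      homotopy_equivalent_space_def by blast
  moreover have "top_of_set S homotopy_equivalent_space sphere_space d"
    using assms by (simp add: sphere_may_be_taken_def homeomorphic_imp_homotopy_equivalent_space)
  ultimately show ?thesis
    using homotopy_equivalent_space_sym homotopy_eqv_trans by metis
qed

text \<open>
  Conjugate the homotopies by the homeomorphism.
\<close>
lemma sphere_may_be_taken_homeomorphic_image:
  fixes f :: "'a::topological_space \<Rightarrow> 'b::topological_space"
  assumes cont: "continuous_on UNIV f" "continuous_on UNIV g"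
    and inv: "\<And>x. g (f x) = x" "\<And>y. f (g y) = y"
    and sph: "sphere_may_be_taken L d S"
  shows "sphere_may_be_taken (f ` L) d (f ` S)"
proof -
  have SL: "S \<subseteq> L" using sph by (simp add: sphere_may_be_taken_def)
  have f: "continuous_map (top_of_set X) (top_of_set (f ` X)) f" for X
    using cont(1) by (auto intro: continuous_on_subset)
  have g: "continuous_map (top_of_set (f ` X)) (top_of_set X) g" for X
    using cont(2) by (auto simp: inv intro: continuous_on_subset)
  have hom: "top_of_set S homeomorphic_space top_of_set (f ` S)"
    unfolding homeomorphic_space_def homeomorphic_maps_def using f g inv by blast
  have "top_of_set (f ` S) homeomorphic_space sphere_space d"
    using sph hom homeomorphic_space_sym homeomorphic_space_trans unfolding sphere_may_be_taken_def by metis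
  moreover obtain k where k: "continuous_map (top_of_set L) (top_of_set S) k"
    "homotopic_with (\<lambda>h. True) (top_of_set S) (top_of_set S) (k \<circ> id) id"
    "homotopic_with (\<lambda>h. True) (top_of_set L) (top_of_set L) (id \<circ> k) id"
    using sph unfolding sphere_may_be_taken_def homotopy_equivalence_map_def by blast
  have conj: "homotopic_with (\<lambda>h. True) (top_of_set (f ` X)) (top_of_set (f ` X)) (f \<circ> k \<circ> g) id"
    if "homotopic_with (\<lambda>h. True) (top_of_set X) (top_of_set X) k id" for X
  proof -
    have "homotopic_with (\<lambda>h. True) (top_of_set (f ` X)) (top_of_set X) (k \<circ> g) (id \<circ> g)"
      using that g by (rule homotopic_with_compose_continuous_map_right) simp
    then have "homotopic_with (\<lambda>h. True) (top_of_set (f ` X)) (top_of_set (f ` X)) (f \<circ> (k \<circ> g)) (f \<circ> (id \<circ> g))"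
      using f by (rule homotopic_with_compose_continuous_map_left) simp
    moreover have "f \<circ> (id \<circ> g) = id" by (auto simp: inv)
    ultimately show ?thesis by (simp add: comp_assoc)
  qed
  have "continuous_map (top_of_set (f ` L)) (top_of_set (f ` S)) (f \<circ> k \<circ> g)"
    by (intro continuous_map_compose[OF g] continuous_map_compose[OF k(1)] f)
  moreover have "continuous_map (top_of_set (f ` S)) (top_of_set (f ` L)) id"
    using SL by auto
  ultimately show ?thesis
    using SL conj k unfolding sphere_may_be_taken_def homotopy_equivalence_map_def
    by (auto intro!: exI[of _ "f \<circ> k \<circ> g"])
qed

text \<open>
  Multiplication by \<open>\<alpha>\<close> carries the link of trace one, where the retraction applies, to the link of
  trace \<open>\<alpha>\<close>.
\<close>
lemma (in star_space) complex_link_homotopy_sphere: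
  assumes "\<alpha> \<noteq> 0"
  shows "top_of_set (complex_link V trace \<alpha>) homotopy_equivalent_space sphere_space (int (cdim V) - 2)"
proof -
  let ?L = "complex_link V trace (of_real 1)" and ?f = "mat_scale \<alpha>" and ?g = "mat_scale (1 / \<alpha>)"
  have inv: "?g (?f A) = A" "?f (?g A) = A" for A :: "complex^'n^'n"
    using assms by (simp_all add: mat_scale_def vec_eq_iff)
  have tr: "trace (mat_scale c A) = c * trace A" for c and A :: "complex^'n^'n"
    by (simp add: trace_def mat_scale_def sum_distrib_left)
  have vec: "mat_scale c A *v v = c *s (A *v v)" for c v and A :: "complex^'n^'n"
    by (simp add: mat_scale_def matrix_vector_mult_def vec_eq_iff sum_distrib_left mult_ac)
  have det: "det (mat_scale c A) = 0" if "det A = 0" for c and A :: "complex^'n^'n"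
    using that by (auto simp: det_eq_0_iff_kernel vec)
  have eq: "complex_link V trace \<alpha> = ?f ` ?L"
  proof
    show "?f ` ?L \<subseteq> complex_link V trace \<alpha>"
      by (auto simp: complex_link_def degenerate_def mat_scale_mem det tr)
    show "complex_link V trace \<alpha> \<subseteq> ?f ` ?L"
    proof
      fix A assume "A \<in> complex_link V trace \<alpha>"
      then have "?g A \<in> ?L"
        using assms by (auto simp: complex_link_def degenerate_def mat_scale_mem det tr)
      then show "A \<in> ?f ` ?L" using inv(2) by (metis image_eqI)
    qed
  qed
  have "sphere_may_be_taken (?f ` ?L) (int (cdim V) - 2) (?f ` {A \<in> ?L. psd A})"
    by (intro sphere_may_be_taken_homeomorphic_image[where g = ?g] sphere_in_complex_link inv
        continuous_intros) simp
  then show ?thesis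
    unfolding eq by (rule homotopy_equivalent_space_if_sphere_may_be_taken)
qed

section \<open>Matrices that are symmetric for a twisted_symmetric transpose\<close>

text \<open>
  For orthogonal \<open>J\<close> the map \<open>B \<mapsto> J B\<^sup>T J\<^sup>T\<close> reverses products and fixes the identity.  With \<open>J = 1\<close>
  its fixed points are the symmetric matrices; with \<open>J\<close> the standard symplectic matrix they are the
  matrices \<open>A J\<^sup>-\<^sup>1\<close>, \<open>A\<close> skew-symmetric.
\<close>
definition twisted_symmetric :: "complex^'m^'m \<Rightarrow> (complex^'m^'m) set" where
  "twisted_symmetric J = {B. J ** transpose B ** transpose J = B}"

lemma transpose_add: "transpose (A + B) = transpose A + transpose B" for A B :: "complex^'n^'n"
  by (simp add: transpose_def vec_eq_iff)

lemma transpose_mat_scale: "transpose (mat_scale c A) = mat_scale c (transpose A)"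
  by (simp add: transpose_def mat_scale_def vec_eq_iff)

lemma twisted_add: "A \<in> twisted_symmetric J \<Longrightarrow> B \<in> twisted_symmetric J \<Longrightarrow> A + B \<in> twisted_symmetric J"
  by (simp add: twisted_symmetric_def transpose_add matrix_add_ldistrib matrix_add_rdistrib)

lemma twisted_mat_scale: "A \<in> twisted_symmetric J \<Longrightarrow> mat_scale c A \<in> twisted_symmetric J"
  by (simp add: twisted_symmetric_def transpose_mat_scale mult_mat_scale mat_scale_mult)

lemma twisted_scaleR: "A \<in> twisted_symmetric J \<Longrightarrow> c *\<^sub>R A \<in> twisted_symmetric J"
  using twisted_mat_scale[of A J "of_real c"] by (simp add: mat_scale_of_real)

lemma twisted_mat_1: "J ** transpose J = mat 1 \<Longrightarrow> mat 1 \<in> twisted_symmetric J"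
  by (simp add: twisted_symmetric_def transpose_mat)

lemma subspace_twisted: "subspace (twisted_symmetric J)"
  by (auto simp: subspace_def twisted_add twisted_scaleR) (simp add: twisted_symmetric_def transpose_def vec_eq_iff matrix_matrix_mult_def)

lemma twisted_square:
  assumes J: "J ** transpose J = mat 1" and Z: "Z \<in> twisted_symmetric J"
  shows "Z ** Z \<in> twisted_symmetric J"
proof -
  have J': "transpose J ** J = mat 1" using J matrix_left_right_inverse by auto
  have "J ** transpose (Z ** Z) ** transpose J = J ** transpose Z ** (transpose J ** J) ** transpose Z ** transpose J"
    by (simp add: J' matrix_transpose_mul matrix_mul_assoc)
  also have "\<dots> = (J ** transpose Z ** transpose J) ** (J ** transpose Z ** transpose J)"
    by (simp add: matrix_mul_assoc)
  also have "\<dots> = Z ** Z" using Z by (simp add: twisted_symmetric_def)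
  finally show ?thesis by (simp add: twisted_symmetric_def)
qed

lemma psd_transpose:
  assumes "psd T"
  shows "psd (transpose T)"
proof -
  have T: "T $ j $ i = cnj (T $ i $ j)" for i j
    using assms unfolding psd_def hermitian_iff_adj[symmetric] hermitian_matrix_def by blast
  have "0 \<le> v \<bullet> (transpose T *v v)" for v
  proof -
    define w where "w = (\<chi> i. cnj (v $ i))"
    have "hermitian_form (transpose T) v = cnj (hermitian_form T w)"
      by (simp add: hermitian_form_def w_def matrix_vector_mult_def transpose_def T[symmetric])
    then show ?thesis
      using assms unfolding Re_hermitian_form[symmetric] by (simp add: psd_def Re_hermitian_form)
  qed
  moreover have "adj (transpose T) = transpose T"
    using assms by (simp add: psd_def flip: transpose_adj)
  ultimately show ?thesis by (simp add: psd_def)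
qed

lemma twisted_adj:
  assumes J: "adj J = transpose J" and B: "B \<in> twisted_symmetric J"
  shows "adj B \<in> twisted_symmetric J"
proof -
  have J': "adj (transpose J) = J" using J adj_adj by metis
  have "J ** transpose (adj B) ** transpose J = adj (J ** transpose B ** transpose J)"
    by (simp add: adj_mult J J' transpose_adj matrix_mul_assoc)
  then show ?thesis using B by (simp add: twisted_symmetric_def)
qed

text \<open>
  The twisted transpose of \<open>|B|\<close> is positive semidefinite, and its square is the twisted transpose of
  \<open>B\<^sup>* B\<close>, that is \<open>B B\<^sup>*\<close>.
\<close>
lemma twisted_matrix_abs:
  assumes J: "adj J = transpose J" "J ** transpose J = mat 1" and B: "B \<in> twisted_symmetric J"
  shows "J ** transpose (matrix_abs B) ** transpose J = matrix_abs (adj B)"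
proof (rule matrix_abs_eqI[symmetric])
  show "psd (J ** transpose (matrix_abs B) ** transpose J)"
    using psd_congruence[OF psd_transpose[OF psd_matrix_abs]] J(1) by metis
  have J': "transpose J ** J = mat 1" using J(2) matrix_left_right_inverse by auto
  have "(J ** transpose (matrix_abs B) ** transpose J) ** (J ** transpose (matrix_abs B) ** transpose J)
      = J ** transpose (matrix_abs B) ** (transpose J ** J) ** transpose (matrix_abs B) ** transpose J"
    by (simp add: matrix_mul_assoc)
  also have "\<dots> = J ** transpose (matrix_abs B ** matrix_abs B) ** transpose J"
    by (simp add: J' matrix_transpose_mul matrix_mul_assoc)
  also have "\<dots> = J ** transpose B ** (transpose J ** J) ** transpose (adj B) ** transpose J"
    by (simp add: J' matrix_abs_square matrix_transpose_mul matrix_mul_assoc)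
  also have "\<dots> = (J ** transpose B ** transpose J) ** (J ** transpose (adj B) ** transpose J)"
    by (simp add: matrix_mul_assoc)
  also have "\<dots> = adj (adj B) ** adj B"
    using B twisted_adj[OF J(1) B] by (simp add: twisted_symmetric_def)
  finally show "(J ** transpose (matrix_abs B) ** transpose J) ** (J ** transpose (matrix_abs B) ** transpose J)
      = adj (adj B) ** adj B" .
qed

lemma star_space_twisted:
  assumes J: "adj J = transpose J" "J ** transpose J = mat 1"
  shows "star_space (twisted_symmetric J)"
proof
  fix A assume A: "A \<in> twisted_symmetric J"
  show "matrix_abs A + matrix_abs (adj A) \<in> twisted_symmetric J"
    using twisted_matrix_abs[OF J A] twisted_matrix_abs[OF J twisted_adj[OF J(1) A]]
    by (simp add: twisted_symmetric_def transpose_add matrix_add_ldistrib matrix_add_rdistrib add.commute)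
qed (simp_all add: twisted_add twisted_mat_scale twisted_mat_1 twisted_adj J)

lemma star_space_sq_mats: "star_space sq_mats"
  by unfold_locales (simp_all add: sq_mats_def)

lemma sym_mats_eq_twisted: "sym_mats = twisted_symmetric (mat 1)"
  by (simp add: sym_mats_def twisted_symmetric_def)

lemma star_space_sym_mats: "star_space sym_mats"
  unfolding sym_mats_eq_twisted by (rule star_space_twisted) (simp_all add: adj_mat)

section \<open>The Pfaffian of a congruent matrix\<close>

lemma prod_pairs:
  fixes h :: "'k::finite \<times> 2 \<Rightarrow> 'a::comm_monoid_mult"
  shows "(\<Prod>x\<in>UNIV. h x) = (\<Prod>i\<in>UNIV. h (i, 1) * h (i, 2))"
proof -
  have "(\<Prod>x\<in>UNIV. h x) = (\<Prod>i\<in>UNIV. \<Prod>b\<in>UNIV. h (i, b))"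
    by (simp add: prod.cartesian_product flip: UNIV_Times_UNIV)
  then show ?thesis by (simp add: UNIV_2)
qed

text \<open>
  The Pfaffian without its normalising factor \<open>2\<^sup>k k!\<close>, which is irrelevant for its zeros.
\<close>
definition pf_sum :: "complex^('k::finite \<times> 2)^('k \<times> 2) \<Rightarrow> complex" where
  "pf_sum A = (\<Sum>p | p permutes (UNIV :: ('k \<times> 2) set).
     of_int (sign p) * (\<Prod>i\<in>UNIV. A $ p (i, 1) $ p (i, 2)))"

lemma pfaffian_eq_0_iff: "pfaffian A = 0 \<longleftrightarrow> pf_sum A = 0"
  by (simp add: pfaffian_def pf_sum_def)

text \<open>
  As a function of \<open>f\<close> this is the determinant of the matrix with the columns of \<open>C\<close> selected by \<open>f\<close>:
  it vanishes if a column is repeated and is \<open>\<plusminus> det C\<close> otherwise.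
\<close>
lemma sum_permutes_rows:
  fixes C :: "complex^'m^'m" and f :: "'m \<Rightarrow> 'm"
  shows "(\<Sum>p | p permutes (UNIV :: 'm set). of_int (sign p) * (\<Prod>x\<in>UNIV. C $ p x $ f x))
    = (if f permutes UNIV then of_int (sign f) * det C else 0)"
proof -
  have "(\<Sum>p | p permutes (UNIV :: 'm set). of_int (sign p) * (\<Prod>x\<in>UNIV. C $ p x $ f x))
      = det (\<chi> x. transpose C $ f x)"
    by (simp add: det_def transpose_def)
  also have "\<dots> = (if f permutes UNIV then of_int (sign f) * det C else 0)"
  proof (cases "f permutes UNIV")
    case True
    then show ?thesis by (simp add: det_permute_rows)
  next
    case False
    then have "\<not> inj f"
      using bij_imp_permutes[of f UNIV] finite_UNIV_inj_surj[of f] by (auto simp: bij_def)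
    then obtain x y where "x \<noteq> y" "f x = f y" by (auto simp: inj_def)
    then show ?thesis using False by (auto intro!: det_identical_rows[of x y] simp: row_def vec_eq_iff)
  qed
  finally show ?thesis .
qed

text \<open>
  Expand the product over the pairs \<open>((i, 1), (i, 2))\<close> into a sum over all maps \<open>f\<close> of the index set
  into itself.  The sum over \<open>p\<close> that multiplies the term of \<open>f\<close> is the one of \<open>sum_permutes_rows\<close>, so
  only permutations \<open>f\<close> contribute, and they give the terms of the Pfaffian of \<open>M\<close> times \<open>det C\<close>.
\<close>
lemma pf_sum_congruence:
  fixes C M :: "complex^('k::finite \<times> 2)^('k \<times> 2)"
  shows "pf_sum (C ** M ** transpose C) = det C * pf_sum M"
proof -
  let ?I = "UNIV :: ('k \<times> 2) set"
  have entry: "(C ** M ** transpose C) $ x $ y = (\<Sum>z\<in>UNIV. C $ x $ fst z * M $ fst z $ snd z * C $ y $ snd z)" for x y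
  proof -
    have "(C ** M ** transpose C) $ x $ y = (\<Sum>b\<in>UNIV. \<Sum>a\<in>UNIV. C $ x $ a * M $ a $ b * C $ y $ b)"
      by (simp add: matrix_matrix_mult_def transpose_def sum_distrib_right)
    also have "\<dots> = (\<Sum>a\<in>UNIV. \<Sum>b\<in>UNIV. C $ x $ a * M $ a $ b * C $ y $ b)" by (rule sum.swap)
    also have "\<dots> = (\<Sum>z\<in>UNIV. C $ x $ fst z * M $ fst z $ snd z * C $ y $ snd z)"
      by (simp add: sum.cartesian_product case_prod_unfold flip: UNIV_Times_UNIV)
    finally show ?thesis .
  qed
  have inverse: "(\<lambda>x. if snd x = 1 then fst (f (fst x, 1), f (fst x, 2)) else snd (f (fst x, 1), f (fst x, 2))) = f" for f :: "'k \<times> 2 \<Rightarrow> 'k \<times> 2"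
  proof
    fix x :: "'k \<times> 2"
    obtain i b where x: "x = (i, b)" by (cases x)
    show "(if snd x = 1 then fst (f (fst x, 1), f (fst x, 2)) else snd (f (fst x, 1), f (fst x, 2))) = f x"
      using exhaust_2[of b] by (auto simp: x)
  qed
  have expand: "(\<Prod>i\<in>UNIV. (C ** M ** transpose C) $ p (i, 1) $ p (i, 2)) =
      (\<Sum>f\<in>UNIV. (\<Prod>i\<in>UNIV. M $ f (i, 1) $ f (i, 2)) * (\<Prod>x\<in>UNIV. C $ p x $ f x))" for p :: "'k \<times> 2 \<Rightarrow> 'k \<times> 2"
  proof -
    have "(\<Prod>i\<in>UNIV. (C ** M ** transpose C) $ p (i, 1) $ p (i, 2)) =
      (\<Sum>g\<in>UNIV. \<Prod>i\<in>UNIV. C $ p (i, 1) $ fst (g i) * M $ fst (g i) $ snd (g i) * C $ p (i, 2) $ snd (g i))"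
      unfolding entry by (subst prod_sum_PiE) auto
    also have "\<dots> = (\<Sum>f\<in>(UNIV :: ('k \<times> 2 \<Rightarrow> 'k \<times> 2) set). \<Prod>i\<in>UNIV. C $ p (i, 1) $ f (i, 1) * M $ f (i, 1) $ f (i, 2) * C $ p (i, 2) $ f (i, 2))"
      by (rule sum.reindex_bij_witness[of _ "\<lambda>(f :: 'k \<times> 2 \<Rightarrow> 'k \<times> 2) i. (f (i, 1), f (i, 2))"
          "\<lambda>g (x :: 'k \<times> 2). if snd x = 1 then fst (g (fst x)) else snd (g (fst x))"]) (auto simp: inverse)
    also have "\<dots> = (\<Sum>f\<in>UNIV. (\<Prod>i\<in>UNIV. M $ f (i, 1) $ f (i, 2)) * (\<Prod>x\<in>UNIV. C $ p x $ f x))"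
      by (simp add: prod_pairs prod.distrib mult_ac)
    finally show ?thesis .
  qed
  have "pf_sum (C ** M ** transpose C) = (\<Sum>f\<in>UNIV. (\<Prod>i\<in>UNIV. M $ f (i, 1) $ f (i, 2)) *
      (\<Sum>p | p permutes ?I. of_int (sign p) * (\<Prod>x\<in>UNIV. C $ p x $ f x)))"
    unfolding pf_sum_def expand sum_distrib_left
    by (subst sum.swap) (simp add: mult_ac)
  also have "\<dots> = (\<Sum>f\<in>UNIV. if f permutes ?I then
      (\<Prod>i\<in>UNIV. M $ f (i, 1) $ f (i, 2)) * (of_int (sign f) * det C) else 0)"
    unfolding sum_permutes_rows by (intro sum.cong) auto
  also have "\<dots> = det C * pf_sum M"
    by (simp add: pf_sum_def sum.If_cases sum_distrib_left mult_ac)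
  finally show ?thesis .
qed

text \<open>
  A transposition of two pairs is a product of two transpositions of indices.
\<close>
lemma sign_map_prod_id:
  fixes \<tau> :: "'k::finite \<Rightarrow> 'k"
  assumes "\<tau> permutes UNIV"
  shows "map_prod \<tau> (id :: 2 \<Rightarrow> 2) permutes UNIV \<and> sign (map_prod \<tau> (id :: 2 \<Rightarrow> 2)) = 1"
  using assms finite
proof (induction rule: permutes_induct)
  case id
  show ?case by (simp only: map_prod.id permutes_id sign_id simp_thms)
next
  case (swap a b \<tau>)
  note IH = swap.IH
  let ?s = "\<lambda>c :: 2. Transposition.transpose (a, c) (b, c)"
  have eq: "map_prod (Transposition.transpose a b \<circ> \<tau>) (id :: 2 \<Rightarrow> 2) = ?s 1 \<circ> (?s 2 \<circ> map_prod \<tau> id)"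
  proof
    fix x :: "'k \<times> 2"
    show "map_prod (Transposition.transpose a b \<circ> \<tau>) id x = (?s 1 \<circ> (?s 2 \<circ> map_prod \<tau> id)) x"
      using exhaust_2[of "snd x"] by (cases x) (auto simp: Transposition.transpose_def)
  qed
  have perm: "?s c permutes UNIV" for c by (rule permutes_swap_id) auto
  have p2: "?s 2 \<circ> map_prod \<tau> id permutes UNIV"
    by (intro permutes_compose[OF conjunct1[OF IH] perm])
  have "sign (?s 1 \<circ> (?s 2 \<circ> map_prod \<tau> id)) = sign (?s 1) * (sign (?s 2) * sign (map_prod \<tau> (id :: 2 \<Rightarrow> 2)))"
    using permutes_imp_permutation[OF finite perm] permutes_imp_permutation[OF finite p2]
      permutes_imp_permutation[OF finite conjunct1[OF IH]] by (simp only: sign_compose)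
  then have "sign (?s 1 \<circ> (?s 2 \<circ> map_prod \<tau> (id :: 2 \<Rightarrow> 2))) = 1"
    using conjunct2[OF IH] swap.hyps by (simp add: sign_swap_id)
  moreover have "?s 1 \<circ> (?s 2 \<circ> map_prod \<tau> (id :: 2 \<Rightarrow> 2)) permutes UNIV"
    by (intro permutes_compose[OF p2 perm])
  ultimately show ?case unfolding eq by blast
qed

lemma skew_unit_nonzero:
  "skew_unit $ x $ y \<noteq> 0 \<longleftrightarrow> fst x = fst y \<and> snd x \<noteq> snd y"
  using exhaust_2[of "snd x"] exhaust_2[of "snd y"] by (auto simp: skew_unit_def)

lemma skew_unit_swap: "skew_unit $ y $ x = - skew_unit $ x $ y"
  using exhaust_2[of "snd x"] exhaust_2[of "snd y"] by (auto simp: skew_unit_def)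

text \<open>
  A term of the Pfaffian of \<open>J\<close> is non-zero only if \<open>p\<close> maps pairs to pairs.  Swapping the two elements
  of one pair changes both the sign of \<open>p\<close> and the sign of one factor.  So all pairs may be assumed
  to be mapped in order, and then \<open>p\<close> is even and all factors are one.
\<close>
lemma pf_term_skew_unit:
  fixes p :: "'k::finite \<times> 2 \<Rightarrow> 'k \<times> 2"
  assumes "p permutes UNIV" "\<And>i. skew_unit $ p (i, 1) $ p (i, 2) \<noteq> 0"
  shows "of_int (sign p) * (\<Prod>i\<in>UNIV. skew_unit $ p (i, 1) $ p (i, 2)) = 1"
  using assms
proof (induction "card {i. snd (p (i, 1)) \<noteq> 1}" arbitrary: p)
  case 0
  then have one: "snd (p (i, 1)) = 1" for i by auto
  have same: "fst (p (i, 1)) = fst (p (i, 2))" "snd (p (i, 2)) = 2" for i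
    using 0(3)[of i] one[of i] exhaust_2[of "snd (p (i, 2))"] by (auto simp: skew_unit_nonzero)
  define \<tau> where "\<tau> i = fst (p (i, 1))" for i
  have p: "p = map_prod \<tau> id"
  proof
    fix x :: "'k \<times> 2"
    obtain i b where x: "x = (i, b)" by (cases x)
    show "p x = map_prod \<tau> id x"
      using exhaust_2[of b] one[of i] same[of i] by (auto simp: x \<tau>_def prod_eq_iff)
  qed
  have "inj p" using 0(2) by (rule permutes_inj)
  then have "inj \<tau>" unfolding p inj_def by (auto dest: spec[where x = "1 :: 2"])
  then have "\<tau> permutes UNIV"
    using bij_imp_permutes[of \<tau> UNIV] finite_UNIV_inj_surj[of \<tau>] by (auto simp: bij_def)
  then have "sign p = 1" using sign_map_prod_id p by auto
  then show ?case by (simp add: p skew_unit_def)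
next
  case (Suc n)
  then obtain i where i: "snd (p (i, 1)) \<noteq> 1"
    by (metis (mono_tags, lifting) card.empty empty_Collect_eq nat.distinct(1))
  let ?s = "Transposition.transpose (i, 1 :: 2) (i, 2)"
  define q where "q = p \<circ> ?s"
  have s: "?s permutes UNIV" by (rule permutes_swap_id) auto
  have q: "q permutes UNIV" unfolding q_def using s Suc(3) by (rule permutes_compose)
  have sign: "sign q = - sign p"
    using permutes_imp_permutation[OF finite s] permutes_imp_permutation[OF finite Suc(3)]
    by (simp add: q_def sign_compose sign_swap_id)
  have qi: "q (i, 1) = p (i, 2)" "q (i, 2) = p (i, 1)" by (simp_all add: q_def)
  have qj: "q (j, b) = p (j, b)" if "j \<noteq> i" for j b
    using that by (simp add: q_def Transposition.transpose_def)
  have nz: "skew_unit $ q (j, 1) $ q (j, 2) \<noteq> 0" for j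
    using Suc(4)[of j] Suc(4)[of i] by (cases "j = i") (auto simp: qi qj skew_unit_nonzero)
  have "snd (p (i, 2)) = 1"
    using Suc(4)[of i] i exhaust_2[of "snd (p (i, 1))"] exhaust_2[of "snd (p (i, 2))"]
    by (auto simp: skew_unit_nonzero)
  then have "j \<in> {j. snd (q (j, 1)) \<noteq> 1} \<longleftrightarrow> j \<in> {j. snd (p (j, 1)) \<noteq> 1} - {i}" for j
    by (cases "j = i") (auto simp: qi qj)
  then have "{j. snd (q (j, 1)) \<noteq> 1} = {j. snd (p (j, 1)) \<noteq> 1} - {i}" by blast
  then have "n = card {j. snd (q (j, 1)) \<noteq> 1}" using Suc(2) i by simp
  then have IH: "of_int (sign q) * (\<Prod>j\<in>UNIV. skew_unit $ q (j, 1) $ q (j, 2)) = 1"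
    using q nz by (rule Suc(1))
  have "(\<Prod>j\<in>UNIV. skew_unit $ q (j, 1) $ q (j, 2)) = (skew_unit $ q (i, 1) $ q (i, 2)) *
      (\<Prod>j\<in>UNIV - {i}. skew_unit $ q (j, 1) $ q (j, 2))"
    by (rule prod.remove) auto
  also have "(\<Prod>j\<in>UNIV - {i}. skew_unit $ q (j, 1) $ q (j, 2)) = (\<Prod>j\<in>UNIV - {i}. skew_unit $ p (j, 1) $ p (j, 2))"
    by (intro prod.cong) (auto simp: qj)
  also have "skew_unit $ q (i, 1) $ q (i, 2) = - skew_unit $ p (i, 1) $ p (i, 2)"
    by (simp add: qi skew_unit_swap[of "p (i, 2)"])
  also have "(- skew_unit $ p (i, 1) $ p (i, 2)) * (\<Prod>j\<in>UNIV - {i}. skew_unit $ p (j, 1) $ p (j, 2))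
      = - (\<Prod>j\<in>UNIV. skew_unit $ p (j, 1) $ p (j, 2))"
    by (subst (2) prod.remove[of _ i]) auto
  finally show ?case using IH sign by simp
qed

text \<open>
  All terms are zero or one, and the identity contributes one.
\<close>
lemma pf_sum_skew_unit: "pf_sum (skew_unit :: complex^('k::finite \<times> 2)^('k \<times> 2)) \<noteq> 0"
proof -
  define t where "t p = of_int (sign p) * (\<Prod>i\<in>UNIV. (skew_unit :: complex^('k \<times> 2)^('k \<times> 2)) $ p (i, 1) $ p (i, 2))" for p
  have t: "t p = 0 \<or> t p = 1" if "p permutes UNIV" for p
    using pf_term_skew_unit[OF that] by (auto simp: t_def)
  have "t id = 1" by (simp add: t_def sign_id skew_unit_def)
  have "1 = (\<Sum>p\<in>{id}. Re (t p))" using \<open>t id = 1\<close> by simp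
  also have "\<dots> \<le> (\<Sum>p | p permutes UNIV. Re (t p))"
    using t by (intro sum_mono2) (auto simp: permutes_id finite_permutations dest!: t)
  also have "\<dots> = Re (pf_sum (skew_unit :: complex^('k \<times> 2)^('k \<times> 2)))"
    by (simp add: pf_sum_def t_def)
  finally show ?thesis by auto
qed

section \<open>Skew eigenvalues are eigenvalues\<close>

lemma skew_unit_orthogonal: "skew_unit ** transpose skew_unit = (mat 1 :: complex^('k::finite \<times> 2)^('k \<times> 2))"
proof -
  define \<sigma> :: "'k \<times> 2 \<Rightarrow> 'k \<times> 2" where "\<sigma> x = (fst x, if snd x = 1 then 2 else 1)" for x
  define \<epsilon> :: "'k \<times> 2 \<Rightarrow> complex" where "\<epsilon> x = (if snd x = 1 then 1 else - 1)" for x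
  have entry: "skew_unit $ x $ y = (if y = \<sigma> x then \<epsilon> x else 0)" for x y
    using exhaust_2[of "snd x"] exhaust_2[of "snd y"]
    by (auto simp: skew_unit_def \<sigma>_def \<epsilon>_def prod_eq_iff)
  have inj: "\<sigma> x = \<sigma> y \<longleftrightarrow> x = y" for x y
    using exhaust_2[of "snd x"] exhaust_2[of "snd y"] by (auto simp: \<sigma>_def prod_eq_iff)
  have "\<epsilon> x * \<epsilon> x = 1" for x by (simp add: \<epsilon>_def)
  then show ?thesis
    by (auto simp: vec_eq_iff matrix_matrix_mult_def transpose_def entry mat_def inj
        if_distrib[where f = "\<lambda>z. z * _"] if_distrib[where f = "\<lambda>z. _ * z"] cong: if_cong)
qed

lemma transpose_skew_unit: "transpose skew_unit = - skew_unit"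
  by (simp add: transpose_def vec_eq_iff skew_unit_swap[symmetric])

lemma adj_skew_unit: "adj skew_unit = transpose skew_unit"
  by (simp add: adj_def transpose_def vec_eq_iff skew_unit_def)

lemma bounded_bilinear_matrix_mult: "bounded_bilinear ((**) :: complex^'n^'n \<Rightarrow> complex^'n^'n \<Rightarrow> complex^'n^'n)"
proof -
  have "bilinear ((**) :: complex^'n^'n \<Rightarrow> complex^'n^'n \<Rightarrow> complex^'n^'n)"
    by (auto simp: bilinear_def intro!: linearI
        simp: matrix_add_ldistrib matrix_add_rdistrib mult_scaleR scaleR_mult)
  then show ?thesis by (simp add: bilinear_conv_bounded_bilinear)
qed

text \<open>
  The equation \<open>(1 - Z)\<^sup>2 = 1 + Y\<close> says that \<open>Z\<close> is a fixed point of \<open>Z \<mapsto> (Z\<^sup>2 - Y) / 2\<close>, which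
  contracts a small ball.  Working inside \<open>W\<close> makes the root inherit every symmetry that is
  preserved by squaring.
\<close>
lemma sqrt_near_one:
  fixes W :: "(complex^'n^'n) set"
  assumes W: "subspace W" and sq: "\<And>Z. Z \<in> W \<Longrightarrow> Z ** Z \<in> W"
  shows "\<exists>d>0. \<forall>Y\<in>W. norm Y \<le> d \<longrightarrow> (\<exists>Z\<in>W. (mat 1 - Z) ** (mat 1 - Z) = mat 1 + Y)"
proof -
  obtain K where K: "K > 0"
    "\<And>(X :: complex^'n^'n) (Y :: complex^'n^'n). norm (X ** Y) \<le> norm X * norm Y * K"
    using bounded_bilinear.pos_bounded[OF bounded_bilinear_matrix_mult[where 'n = 'n]] by blast
  \<comment> \<open>On the ball of radius \<open>d\<close> squaring has Lipschitz constant \<open>2 K d = 1\<close>, and \<open>K d\<^sup>2 + d \<le> 2 d\<close>.\<close>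
  define d where "d = 1 / (2 * K)"
  have d: "d > 0" "K * d = 1 / 2" using K by (simp_all add: d_def)
  have "\<exists>Z\<in>W. (mat 1 - Z) ** (mat 1 - Z) = mat 1 + Y" if Y: "Y \<in> W" "norm Y \<le> d" for Y
  proof -
    define f where "f Z = (1/2) *\<^sub>R (Z ** Z - Y)" for Z
    let ?S = "W \<inter> cball 0 d"
    have "\<exists>!Z. Z \<in> ?S \<and> f Z = Z"
    proof (rule Banach_fix)
      show "complete ?S"
        using W by (simp add: complete_eq_closed closed_Int closed_subspace)
      show "?S \<noteq> {}" using subspace_0[OF W] d by auto
      show "f ` ?S \<subseteq> ?S"
      proof (intro image_subsetI IntI)
        fix Z assume Z: "Z \<in> ?S"
        show "f Z \<in> W" unfolding f_def using Z Y by (intro subspace_scale subspace_diff W sq) auto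
        have "norm (f Z) = norm (Z ** Z - Y) / 2" by (simp add: f_def)
        also have "norm (Z ** Z - Y) \<le> norm (Z ** Z) + norm Y" by (rule norm_triangle_ineq4)
        also have "norm (Z ** Z) \<le> norm Z * norm Z * K" by (rule K)
        also have "norm Z * norm Z * K \<le> d * d * K"
          using Z K d by (intro mult_right_mono mult_mono) auto
        also have "d * d * K = d / 2" using d(2) by (simp add: mult_ac)
        finally show "f Z \<in> cball 0 d" using Y(2) d by simp
      qed
      show "dist (f X) (f Z) \<le> 1/2 * dist X Z" if "X \<in> ?S" "Z \<in> ?S" for X Z
      proof -
        have "f X - f Z = (1/2) *\<^sub>R (X ** (X - Z) + (X - Z) ** Z)"
          by (simp add: f_def matrix_diff_ldistrib matrix_diff_rdistrib flip: scaleR_diff_right)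
        then have "norm (f X - f Z) \<le> (norm (X ** (X - Z)) + norm ((X - Z) ** Z)) / 2"
          by (simp add: norm_triangle_ineq)
        also have "\<dots> \<le> (d * norm (X - Z) * K + norm (X - Z) * d * K) / 2"
        proof (intro divide_right_mono add_mono)
          have "norm X * norm (X - Z) * K \<le> d * norm (X - Z) * K"
            using that K by (intro mult_right_mono) auto
          then show "norm (X ** (X - Z)) \<le> d * norm (X - Z) * K" using K(2) order_trans by blast
          have "norm (X - Z) * norm Z * K \<le> norm (X - Z) * d * K"
            using that K by (intro mult_right_mono mult_left_mono) auto
          then show "norm ((X - Z) ** Z) \<le> norm (X - Z) * d * K" using K(2) order_trans by blast
        qed simp
        also have "\<dots> = (K * d) * norm (X - Z)" by (simp add: algebra_simps)
        finally show ?thesis by (simp add: d(2) dist_norm)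
      qed
    qed auto
    then obtain Z where Z: "Z \<in> W" "f Z = Z" by auto
    have "2 *\<^sub>R f Z = Z ** Z - Y" by (simp add: f_def)
    then have "Z + Z = Z ** Z - Y" using Z(2) by (simp add: scaleR_2)
    then have "(mat 1 - Z) ** (mat 1 - Z) = mat 1 + Y"
      by (simp add: matrix_diff_ldistrib matrix_diff_rdistrib algebra_simps)
    then show ?thesis using Z(1) by blast
  qed
  then show ?thesis using d(1) by blast
qed

text \<open>
  Only the existence of a polynomial matters below, not its coefficients.
\<close>
definition poly_fun :: "(complex \<Rightarrow> complex) \<Rightarrow> bool" where
  "poly_fun f \<longleftrightarrow> (\<exists>p. \<forall>s. f s = poly p s)"

lemma poly_fun_const: "poly_fun (\<lambda>s. c)"
  unfolding poly_fun_def by (rule exI[of _ "[:c:]"]) simp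

lemma poly_fun_id: "poly_fun (\<lambda>s. s)"
  unfolding poly_fun_def by (rule exI[of _ "[:0, 1:]"]) simp

lemma poly_fun_add: "poly_fun f \<Longrightarrow> poly_fun g \<Longrightarrow> poly_fun (\<lambda>s. f s + g s)"
  unfolding poly_fun_def by (metis poly_add)

lemma poly_fun_mult: "poly_fun f \<Longrightarrow> poly_fun g \<Longrightarrow> poly_fun (\<lambda>s. f s * g s)"
  unfolding poly_fun_def by (metis poly_mult)

lemma poly_fun_sum: "(\<And>i. i \<in> I \<Longrightarrow> poly_fun (f i)) \<Longrightarrow> poly_fun (\<lambda>s. \<Sum>i\<in>I. f i s)"
  by (induction I rule: infinite_finite_induct) (auto intro: poly_fun_const poly_fun_add)

lemma poly_fun_prod: "(\<And>i. i \<in> I \<Longrightarrow> poly_fun (f i)) \<Longrightarrow> poly_fun (\<lambda>s. \<Prod>i\<in>I. f i s)"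
  by (induction I rule: infinite_finite_induct) (auto intro: poly_fun_const poly_fun_mult)

lemmas poly_fun_intros = poly_fun_const poly_fun_id poly_fun_add poly_fun_mult poly_fun_sum poly_fun_prod

lemma poly_fun_eq_0:
  assumes "poly_fun f" "\<And>s :: real. s \<ge> b \<Longrightarrow> f (of_real s) = 0"
  shows "f s = 0"
proof -
  obtain p where p: "\<And>s. f s = poly p s" using assms(1) by (auto simp: poly_fun_def)
  have "infinite (complex_of_real ` {b..})"
    by (subst finite_image_iff) (auto simp: inj_on_def infinite_Ici)
  moreover have "complex_of_real ` {b..} \<subseteq> {s. poly p s = 0}" using assms(2) p by auto
  ultimately have "p = 0" using poly_roots_finite finite_subset by blast
  then show ?thesis by (simp add: p)
qed

text \<open>
  For large real \<open>s\<close> the matrix \<open>X + s\<^sup>2\<close> is a square \<open>C\<^sup>2\<close> with \<open>C\<close> twisted symmetric, and then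
  \<open>(X + s\<^sup>2) J = C J C\<^sup>T\<close>.  So the identity holds for \<open>X + s\<^sup>2\<close>, and being polynomial in \<open>s\<close> it
  holds for \<open>s = 0\<close>.
\<close>
lemma pf_sum_square:
  fixes X :: "complex^('k::finite \<times> 2)^('k \<times> 2)"
  assumes X: "X \<in> twisted_symmetric skew_unit"
  shows "(pf_sum (X ** skew_unit))\<^sup>2 = det X * (pf_sum (skew_unit :: complex^('k \<times> 2)^('k \<times> 2)))\<^sup>2"
proof -
  define J where "J = (skew_unit :: complex^('k \<times> 2)^('k \<times> 2))"
  have JJ: "J ** transpose J = mat 1" "transpose J ** J = mat 1"
    using skew_unit_orthogonal matrix_left_right_inverse by (auto simp: J_def)
  define W where "W = twisted_symmetric J"
  obtain d where d: "d > 0" "\<And>Y. Y \<in> W \<Longrightarrow> norm Y \<le> d \<Longrightarrow> \<exists>Z\<in>W. (mat 1 - Z) ** (mat 1 - Z) = mat 1 + Y"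
    using sqrt_near_one[of W, OF _ twisted_square[OF JJ(1), folded W_def]] subspace_twisted[of J]
    unfolding W_def by blast
  define X' where "X' s = X + mat_scale (s * s) (mat 1)" for s
  define F where "F s = (pf_sum (X' s ** J))\<^sup>2 + (- 1) * (det (X' s) * (pf_sum J)\<^sup>2)" for s
  have entry: "poly_fun (\<lambda>s. X' s $ x $ y)" for x y
    by (simp add: X'_def mat_scale_def) (intro poly_fun_intros)
  have "poly_fun F"
    unfolding F_def pf_sum_def det_def power2_eq_square matrix_matrix_mult_def vec_lambda_beta
    by (intro poly_fun_intros entry)
  moreover have "F (of_real s) = 0" if s: "s \<ge> sqrt (norm X / d) + 1" for s
  proof -
    have s1: "s \<ge> 1" using s d by (smt (verit) real_sqrt_ge_zero norm_ge_zero divide_nonneg_pos)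
    have "norm X / d \<le> s\<^sup>2"
      using s d by (intro sqrt_le_D) linarith
    then have "norm ((1 / s\<^sup>2) *\<^sub>R X) \<le> d" using s1 d by (simp add: field_simps)
    moreover have "(1 / s\<^sup>2) *\<^sub>R X \<in> W" using X by (simp add: W_def J_def twisted_scaleR)
    ultimately obtain Z where Z: "Z \<in> W" "(mat 1 - Z) ** (mat 1 - Z) = mat 1 + (1 / s\<^sup>2) *\<^sub>R X"
      using d(2) by blast
    define C where "C = s *\<^sub>R (mat 1 - Z)"
    have "C \<in> W" unfolding C_def W_def
      using Z(1) by (intro subspace_scale subspace_diff subspace_twisted twisted_mat_1 JJ) (simp add: W_def)
    have CC: "C ** C = X' (of_real s)"
    proof -
      have "C ** C = s\<^sup>2 *\<^sub>R (mat 1 + (1 / s\<^sup>2) *\<^sub>R X)"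
        by (simp add: C_def mult_scaleR scaleR_mult Z(2) power2_eq_square)
      also have "\<dots> = X + s\<^sup>2 *\<^sub>R mat 1" using s1 by (simp add: scaleR_right_distrib)
      finally show ?thesis by (simp add: X'_def power2_eq_square flip: mat_scale_of_real)
    qed
    have "C ** J ** transpose C = C ** J ** transpose C ** (transpose J ** J)" by (simp add: JJ)
    also have "\<dots> = C ** (J ** transpose C ** transpose J) ** J" by (simp add: matrix_mul_assoc)
    also have "\<dots> = X' (of_real s) ** J" using \<open>C \<in> W\<close> CC by (simp add: W_def twisted_symmetric_def)
    finally have "pf_sum (X' (of_real s) ** J) = det C * pf_sum J" by (metis pf_sum_congruence)
    moreover have "det (X' (of_real s)) = (det C)\<^sup>2" by (simp add: det_mul power2_eq_square flip: CC)
    ultimately show ?thesis by (simp add: F_def power_mult_distrib)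
  qed
  ultimately have "F 0 = 0" by (rule poly_fun_eq_0)
  moreover have "X' 0 = X" by (simp add: X'_def mat_scale_def vec_eq_iff)
  ultimately show ?thesis by (simp add: F_def J_def)
qed

lemma eigenvalue_iff_det: "eigenvalue B \<mu> \<longleftrightarrow> det (B - mat \<mu>) = 0"
  by (simp add: eigenvalue_def det_eq_0_iff_kernel matrix_vector_mult_diff_rdistrib mat_mult_vec)

lemma skew_eigenvalue_iff_eigenvalue:
  fixes B :: "complex^('k::finite \<times> 2)^('k \<times> 2)"
  assumes "B \<in> twisted_symmetric skew_unit"
  shows "skew_eigenvalue (B ** skew_unit) \<mu> \<longleftrightarrow> eigenvalue B \<mu>"
proof -
  have eq: "B - mat \<mu> = B + mat_scale (- \<mu>) (mat 1)"
    by (simp add: vec_eq_iff mat_def mat_scale_def)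
  have "B - mat \<mu> \<in> twisted_symmetric skew_unit"
    unfolding eq by (intro twisted_add twisted_mat_scale twisted_mat_1 assms skew_unit_orthogonal)
  then have "(pf_sum ((B - mat \<mu>) ** skew_unit))\<^sup>2 =
      det (B - mat \<mu>) * (pf_sum (skew_unit :: complex^('k \<times> 2)^('k \<times> 2)))\<^sup>2"
    by (rule pf_sum_square)
  moreover have "(B - mat \<mu>) ** skew_unit = B ** skew_unit - mat_scale \<mu> skew_unit"
    by (simp add: matrix_diff_rdistrib mat_eq_mat_scale[of \<mu>] mat_scale_mult)
  ultimately show ?thesis
    by (auto simp: skew_eigenvalue_def pfaffian_eq_0_iff eigenvalue_iff_det
        pf_sum_skew_unit power2_eq_square)
qed

section \<open>Skew-symmetric and quaternionic matrices\<close>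

lemma cdim_linear_image:
  fixes f :: "complex^'m^'n \<Rightarrow> complex^'p^'q"
  assumes f: "Vector_Spaces.linear mat_scale mat_scale f" and inj: "inj f"
  shows "cdim (f ` V) = cdim V"
proof -
  interpret Vector_Spaces.linear mat_scale mat_scale f by (rule f)
  obtain B where B: "B \<subseteq> V" "cmat.independent B" "V \<subseteq> cmat.span B" "card B = cmat.dim V"
    by (rule cmat.basis_exists)
  have "cmat.dim (f ` V) = card (f ` B)"
  proof (rule cmat.dim_unique)
    show "f ` B \<subseteq> f ` V" using B(1) by blast
    show "f ` V \<subseteq> cmat.span (f ` B)" using B(3) by (simp add: span_image image_mono)
    show "cmat.independent (f ` B)"
      using B(2) inj by (intro independent_injective_image inj_on_subset[OF inj]) auto
  qed simp
  also have "\<dots> = cmat.dim V" using B(4) inj by (simp add: card_image inj_on_subset)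
  finally show ?thesis by (simp add: cdim_def)
qed

abbreviation skew_space :: "(complex^('k::finite \<times> 2)^('k \<times> 2)) set" where
  "skew_space \<equiv> twisted_symmetric skew_unit"

lemma star_space_skew_space: "star_space skew_space"
  by (intro star_space_twisted adj_skew_unit skew_unit_orthogonal)

lemma skew_unit_transpose_mult: "transpose skew_unit ** skew_unit = (mat 1 :: complex^('k::finite \<times> 2)^('k \<times> 2))"
  using skew_unit_orthogonal matrix_left_right_inverse by blast

lemma mult_skew_unit_inverse:
  "B ** skew_unit ** transpose skew_unit = B" "A ** transpose skew_unit ** skew_unit = A"
  for A B :: "complex^('k::finite \<times> 2)^('k \<times> 2)"
  by (simp_all add: skew_unit_orthogonal skew_unit_transpose_mult flip: matrix_mul_assoc)

lemma matrix_mult_uminus: "A ** (- B) = - (A ** B)" "(- A) ** B = - (A ** B)" for A B :: "complex^'n^'n"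
  by (simp_all add: matrix_matrix_mult_def vec_eq_iff sum_negf)

lemma skew_mats_entry:
  assumes "A \<in> skew_mats"
  shows "A $ y $ x = - A $ x $ y"
proof -
  have "transpose A $ x $ y = (- A) $ x $ y" using assms by (simp add: skew_mats_def)
  then show ?thesis by (simp add: transpose_def)
qed

lemma inj_mult_skew_unit: "inj (\<lambda>B :: complex^('k::finite \<times> 2)^('k \<times> 2). B ** skew_unit)"
  using mult_skew_unit_inverse(1) by (rule inj_on_inverseI)

text \<open>
  Multiplication by \<open>J\<close> turns the twisted transpose into minus the transpose, as \<open>J\<^sup>T = -J\<close>.
\<close>
lemma mult_skew_unit_skew_iff:
  fixes B :: "complex^('k::finite \<times> 2)^('k \<times> 2)"
  shows "B ** skew_unit \<in> skew_mats \<longleftrightarrow> B \<in> skew_space"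
proof -
  define J where "J = (skew_unit :: complex^('k \<times> 2)^('k \<times> 2))"
  have JT: "transpose J = - J" by (simp add: J_def transpose_skew_unit)
  have "B \<in> skew_space \<longleftrightarrow> J ** transpose B ** transpose J ** J = B ** J"
    using inj_eq[OF inj_mult_skew_unit, of "J ** transpose B ** transpose J" B]
    by (simp add: twisted_symmetric_def J_def)
  also have "J ** transpose B ** transpose J ** J = J ** transpose B"
    by (simp add: J_def mult_skew_unit_inverse)
  also have "J ** transpose B = - transpose (B ** J)"
    by (simp add: matrix_transpose_mul JT matrix_mult_uminus)
  finally show ?thesis unfolding skew_mats_def J_def by (auto simp: minus_equation_iff)
qed

lemma skew_mats_eq_image:
  "(skew_mats :: (complex^('k::finite \<times> 2)^('k \<times> 2)) set) = (\<lambda>B. B ** skew_unit) ` skew_space"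
proof
  show "(\<lambda>B. B ** skew_unit) ` skew_space \<subseteq> (skew_mats :: (complex^('k \<times> 2)^('k \<times> 2)) set)" using mult_skew_unit_skew_iff by auto
  show "(skew_mats :: (complex^('k \<times> 2)^('k \<times> 2)) set) \<subseteq> (\<lambda>B. B ** skew_unit) ` skew_space"
  proof
    fix A :: "complex^('k \<times> 2)^('k \<times> 2)" assume "A \<in> skew_mats"
    then have "A ** transpose skew_unit \<in> skew_space"
      by (simp add: mult_skew_unit_inverse flip: mult_skew_unit_skew_iff)
    then show "A \<in> (\<lambda>B. B ** skew_unit) ` skew_space"
      by (rule rev_image_eqI) (simp add: mult_skew_unit_inverse)
  qed
qed

lemma cdim_skew_mats:
  "cdim (skew_mats :: (complex^('k::finite \<times> 2)^('k \<times> 2)) set)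
    = cdim (skew_space :: (complex^('k \<times> 2)^('k \<times> 2)) set)"
  unfolding skew_mats_eq_image
proof (rule cdim_linear_image[OF _ inj_mult_skew_unit])
  show "Vector_Spaces.linear mat_scale mat_scale (\<lambda>B :: complex^('k \<times> 2)^('k \<times> 2). B ** skew_unit)"
    unfolding Vector_Spaces.linear_iff
    by (simp add: vector_space_mat_scale matrix_add_rdistrib mat_scale_mult)
qed

lemma det_mult_skew_unit_eq_0_iff: "det (B ** skew_unit) = 0 \<longleftrightarrow> det B = 0"
  for B :: "complex^('k::finite \<times> 2)^('k \<times> 2)"
proof -
  have "det (skew_unit :: complex^('k \<times> 2)^('k \<times> 2)) \<noteq> 0"
    using skew_unit_orthogonal by (metis det_I det_mul mult_zero_left zero_neq_one)
  then show ?thesis by (simp add: det_mul)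
qed

text \<open>
  Each entry \<open>a\<^sub>1\<^sub>2\<close> of a diagonal cell appears twice on the diagonal of \<open>A J\<^sup>-\<^sup>1\<close>, once as \<open>-a\<^sub>2\<^sub>1\<close>.
\<close>
lemma trace_eq_skew_trace:
  fixes B :: "complex^('k::finite \<times> 2)^('k \<times> 2)"
  assumes "B \<in> skew_space"
  shows "trace B = 2 * skew_trace (B ** skew_unit)"
proof -
  define A where "A = B ** skew_unit"
  have A: "A \<in> skew_mats" using assms mult_skew_unit_skew_iff A_def by metis
  have B: "B = A ** transpose skew_unit" by (simp add: A_def mult_skew_unit_inverse)
  have diag: "B $ (i, 1) $ (i, 1) = A $ (i, 1) $ (i, 2)" "B $ (i, 2) $ (i, 2) = - A $ (i, 2) $ (i, 1)" for i
  proof -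
    have col1: "(skew_unit :: complex^('k \<times> 2)^('k \<times> 2)) $ (i, 1) $ y = (if y = (i, 2) then 1 else 0)" for y
      using exhaust_2[of "snd y"] by (auto simp: skew_unit_def prod_eq_iff)
    have col2: "(skew_unit :: complex^('k \<times> 2)^('k \<times> 2)) $ (i, 2) $ y = (if y = (i, 1) then - 1 else 0)" for y
      using exhaust_2[of "snd y"] by (auto simp: skew_unit_def prod_eq_iff)
    show "B $ (i, 1) $ (i, 1) = A $ (i, 1) $ (i, 2)" "B $ (i, 2) $ (i, 2) = - A $ (i, 2) $ (i, 1)"
      unfolding B by (simp_all add: matrix_matrix_mult_def transpose_def col1 col2
          if_distrib[where f = "\<lambda>z. _ * z"] cong: if_cong)
  qed
  have skew: "A $ y $ x = - A $ x $ y" for x y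
    using A by (rule skew_mats_entry)
  have "trace B = (\<Sum>i\<in>UNIV. B $ (i, 1) $ (i, 1) + B $ (i, 2) $ (i, 2))"
  proof -
    have "trace B = (\<Sum>i\<in>UNIV. \<Sum>b\<in>UNIV. B $ (i, b) $ (i, b))"
      by (simp add: trace_def sum.cartesian_product flip: UNIV_Times_UNIV)
    then show ?thesis by (simp add: UNIV_2)
  qed
  also have "\<dots> = (\<Sum>i\<in>UNIV. 2 * A $ (i, 1) $ (i, 2))"
    using skew[of "(_, 2)" "(_, 1)"] by (simp add: diag)
  finally show ?thesis by (simp add: skew_trace_def A_def sum_distrib_left)
qed

text \<open>
  A matrix is quaternionic if and only if conjugation by \<open>J\<close> turns it into its complex conjugate; for
  skew-symmetric \<open>A = B J\<close> this is the condition that \<open>B\<close> equals its adjoint.  The proof compares the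
  entries of the cells.
\<close>
lemma quaternionic_iff_hermitian:
  fixes B :: "complex^('k::finite \<times> 2)^('k \<times> 2)"
  assumes "B \<in> skew_space"
  shows "quaternionic_matrix (B ** skew_unit) \<longleftrightarrow> adj B = B"
proof -
  define J where "J = (skew_unit :: complex^('k \<times> 2)^('k \<times> 2))"
  define A where "A = B ** J"
  have skew: "A $ y $ x = - A $ x $ y" for x y
  proof -
    have "A \<in> skew_mats" using assms mult_skew_unit_skew_iff A_def J_def by metis
    then show ?thesis by (rule skew_mats_entry)
  qed
  have right: "B $ x $ (j, 1) = A $ x $ (j, 2)" "B $ x $ (j, 2) = - A $ x $ (j, 1)" for x j
  proof -
    have B: "B = A ** transpose J" by (simp add: A_def J_def mult_skew_unit_inverse)
    have col1: "J $ (i, 1) $ y = (if y = (i, 2) then 1 else 0)" for i y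
      using exhaust_2[of "snd y"] by (auto simp: J_def skew_unit_def prod_eq_iff)
    have col2: "J $ (i, 2) $ y = (if y = (i, 1) then - 1 else 0)" for i y
      using exhaust_2[of "snd y"] by (auto simp: J_def skew_unit_def prod_eq_iff)
    show "B $ x $ (j, 1) = A $ x $ (j, 2)" "B $ x $ (j, 2) = - A $ x $ (j, 1)"
      unfolding B by (simp_all add: matrix_matrix_mult_def transpose_def col1 col2
          if_distrib[where f = "\<lambda>z. _ * z"] cong: if_cong)
  qed
  have "adj B = B \<longleftrightarrow> (\<forall>i j. cnj (B $ (j, 1) $ (i, 1)) = B $ (i, 1) $ (j, 1) \<and>
      cnj (B $ (j, 1) $ (i, 2)) = B $ (i, 2) $ (j, 1) \<and> cnj (B $ (j, 2) $ (i, 1)) = B $ (i, 1) $ (j, 2) \<and>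
      cnj (B $ (j, 2) $ (i, 2)) = B $ (i, 2) $ (j, 2))"
    by (auto simp: adj_def vec_eq_iff forall_2)
  also have "\<dots> \<longleftrightarrow> (\<forall>i j. cnj (A $ (j, 1) $ (i, 2)) = A $ (i, 1) $ (j, 2) \<and>
      - cnj (A $ (j, 1) $ (i, 1)) = A $ (i, 2) $ (j, 2) \<and> cnj (A $ (j, 2) $ (i, 2)) = - A $ (i, 1) $ (j, 1) \<and>
      cnj (A $ (j, 2) $ (i, 1)) = A $ (i, 2) $ (j, 1))"
    unfolding right by simp
  also have "\<dots> \<longleftrightarrow> (\<forall>i j. A $ (i, 2) $ (j, 1) = - cnj (A $ (i, 1) $ (j, 2)) \<and> A $ (i, 2) $ (j, 2) = cnj (A $ (i, 1) $ (j, 1)))"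
    (is "(\<forall>i j. ?P i j) \<longleftrightarrow> (\<forall>i j. ?Q i j)")
  proof (intro iffI allI)
    fix i j assume "\<forall>i j. ?P i j"
    then have "?P j i" "?P i j" by blast+
    then show "?Q i j"
      using skew[of "(j, 1)" "(i, 1)"] skew[of "(j, 1)" "(i, 2)"] skew[of "(j, 2)" "(i, 1)"]
      by (metis complex_cnj_cnj complex_cnj_minus minus_minus)
  next
    fix i j assume "\<forall>i j. ?Q i j"
    then have "?Q j i" "?Q i j" by blast+
    then show "?P i j"
      using skew[of "(j, 1)" "(i, 1)"] skew[of "(j, 1)" "(i, 2)"] skew[of "(j, 2)" "(i, 1)"] skew[of "(j, 2)" "(i, 2)"]
      by (metis complex_cnj_cnj complex_cnj_minus minus_minus)
  qed
  also have "\<dots> \<longleftrightarrow> quaternionic_matrix A" by (simp add: quaternionic_matrix_def)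
  finally show ?thesis by (simp add: A_def J_def)
qed

lemma complex_link_skew_mats:
  "complex_link (skew_mats :: (complex^('k::finite \<times> 2)^('k \<times> 2)) set) skew_trace \<alpha>
    = (\<lambda>B. B ** skew_unit) ` complex_link skew_space trace (2 * \<alpha>)"
  unfolding complex_link_def degenerate_def skew_mats_eq_image
  by (auto simp: det_mult_skew_unit_eq_0_iff trace_eq_skew_trace)

lemma homeomorphic_space_mult_skew_unit:
  fixes X :: "(complex^('k::finite \<times> 2)^('k \<times> 2)) set"
  shows "top_of_set X homeomorphic_space top_of_set ((\<lambda>B. B ** skew_unit) ` X)"
proof -
  have "homeomorphic_maps (top_of_set X) (top_of_set ((\<lambda>B. B ** skew_unit) ` X))
      (\<lambda>B. B ** skew_unit) (\<lambda>A. A ** transpose skew_unit)"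
    by (auto simp: homeomorphic_maps_def mult_skew_unit_inverse intro!: continuous_intros)
  then show ?thesis by (auto simp: homeomorphic_space_def)
qed

lemma sphere_may_be_taken_mult_skew_unit:
  fixes L :: "(complex^('k::finite \<times> 2)^('k \<times> 2)) set"
  assumes "sphere_may_be_taken L d S"
  shows "sphere_may_be_taken ((\<lambda>B. B ** skew_unit) ` L) d ((\<lambda>B. B ** skew_unit) ` S)"
  using assms
  by (intro sphere_may_be_taken_homeomorphic_image[where g = "\<lambda>A. A ** transpose skew_unit"]
      continuous_intros mult_skew_unit_inverse)

section \<open>The three families of matrices\<close>

lemma sym_sphere_eq:
  "{A \<in> degenerate sym_mats. real_matrix A \<and> trace A = \<alpha> \<and> (\<forall>\<mu>. eigenvalue A \<mu> \<longrightarrow> \<mu> \<in> \<real>\<^sub>\<ge>\<^sub>0)}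
    = {A \<in> complex_link sym_mats trace \<alpha>. psd A}"
proof -
  have "real_matrix A \<longleftrightarrow> adj A = A" if "A \<in> sym_mats" for A :: "complex^'n^'n"
  proof -
    have "A $ j $ i = A $ i $ j" for i j
    proof -
      have "transpose A $ i $ j = A $ i $ j" using that by (simp add: sym_mats_def)
      then show ?thesis by (simp add: transpose_def)
    qed
    then have "adj A = (\<chi> i j. cnj (A $ i $ j))" by (simp add: adj_def)
    then show ?thesis by (simp add: real_matrix_def vec_eq_iff Reals_cnj_iff)
  qed
  moreover have "psd A \<longleftrightarrow> adj A = A \<and> (\<forall>\<mu>. eigenvalue A \<mu> \<longrightarrow> \<mu> \<in> \<real>\<^sub>\<ge>\<^sub>0)" for A :: "complex^'n^'n"
    using psd_iff_eigenvalues psd_def by blast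
  ultimately show ?thesis by (auto simp: complex_link_def degenerate_def)
qed

lemma sq_sphere_eq:
  "{A \<in> degenerate sq_mats. hermitian_matrix A \<and> trace A = \<alpha> \<and> (\<forall>\<mu>. eigenvalue A \<mu> \<longrightarrow> \<mu> \<in> \<real>\<^sub>\<ge>\<^sub>0)}
    = {A \<in> complex_link sq_mats trace \<alpha>. psd A}"
  using psd_iff_eigenvalues psd_def hermitian_iff_adj
  by (fastforce simp: complex_link_def degenerate_def)

lemma skew_sphere_eq:
  "{A \<in> degenerate (skew_mats :: (complex^('k::finite \<times> 2)^('k \<times> 2)) set). quaternionic_matrix A \<and>
      skew_trace A = \<alpha> \<and> (\<forall>\<mu>. skew_eigenvalue A \<mu> \<longrightarrow> \<mu> \<in> \<real>\<^sub>\<ge>\<^sub>0)}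
    = (\<lambda>B. B ** skew_unit) ` {B \<in> complex_link skew_space trace (2 * \<alpha>). psd B}"
proof -
  have psd: "psd B \<longleftrightarrow> quaternionic_matrix (B ** skew_unit) \<and>
      (\<forall>\<mu>. skew_eigenvalue (B ** skew_unit) \<mu> \<longrightarrow> \<mu> \<in> \<real>\<^sub>\<ge>\<^sub>0)"
    if "B \<in> skew_space" for B :: "complex^('k \<times> 2)^('k \<times> 2)"
    using that psd_iff_eigenvalues[of B]
    by (auto simp: quaternionic_iff_hermitian skew_eigenvalue_iff_eigenvalue psd_def)
  have "{A \<in> degenerate (skew_mats :: (complex^('k \<times> 2)^('k \<times> 2)) set). quaternionic_matrix A \<and>
      skew_trace A = \<alpha> \<and> (\<forall>\<mu>. skew_eigenvalue A \<mu> \<longrightarrow> \<mu> \<in> \<real>\<^sub>\<ge>\<^sub>0)}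
    = {A \<in> complex_link skew_mats skew_trace \<alpha>. quaternionic_matrix A \<and>
        (\<forall>\<mu>. skew_eigenvalue A \<mu> \<longrightarrow> \<mu> \<in> \<real>\<^sub>\<ge>\<^sub>0)}"
    by (auto simp: complex_link_def)
  also have "\<dots> = (\<lambda>B. B ** skew_unit) ` {B \<in> complex_link skew_space trace (2 * \<alpha>). psd B}"
    unfolding complex_link_skew_mats using psd by (auto simp: complex_link_def degenerate_def)
  finally show ?thesis .
qed

theorem theorem2p1:
  shows
    "((\<forall>\<alpha>::complex. \<alpha> \<noteq> 0 \<longrightarrow>
         top_of_set (complex_link (sym_mats :: (complex^'n^'n) set) trace \<alpha>)
           homotopy_equivalent_space
         sphere_space (int (cdim (sym_mats :: (complex^'n^'n) set)) - 2)) \<and>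
      (\<forall>l::real. l > 0 \<longrightarrow>
         sphere_may_be_taken
           (complex_link (sym_mats :: (complex^'n^'n) set) trace
              (of_real (real CARD('n) * l)))
           (int (cdim (sym_mats :: (complex^'n^'n) set)) - 2)
           {A \<in> degenerate sym_mats. real_matrix A \<and>
              trace A = of_real (real CARD('n) * l) \<and>
              (\<forall>\<mu>. eigenvalue A \<mu> \<longrightarrow> \<mu> \<in> \<real>\<^sub>\<ge>\<^sub>0)}))
     \<and>
     ((\<forall>\<alpha>::complex. \<alpha> \<noteq> 0 \<longrightarrow>
         top_of_set (complex_link (sq_mats :: (complex^'n^'n) set) trace \<alpha>)
           homotopy_equivalent_space
         sphere_space (int (cdim (sq_mats :: (complex^'n^'n) set)) - 2)) \<and>
      (\<forall>l::real. l > 0 \<longrightarrow>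
         sphere_may_be_taken
           (complex_link (sq_mats :: (complex^'n^'n) set) trace
              (of_real (real CARD('n) * l)))
           (int (cdim (sq_mats :: (complex^'n^'n) set)) - 2)
           {A \<in> degenerate sq_mats. hermitian_matrix A \<and>
              trace A = of_real (real CARD('n) * l) \<and>
              (\<forall>\<mu>. eigenvalue A \<mu> \<longrightarrow> \<mu> \<in> \<real>\<^sub>\<ge>\<^sub>0)}))
     \<and>
     ((\<forall>\<alpha>::complex. \<alpha> \<noteq> 0 \<longrightarrow>
         top_of_set (complex_link (skew_mats :: (complex^('k::finite \<times> 2)^('k \<times> 2)) set) skew_trace \<alpha>)
           homotopy_equivalent_space
         sphere_space (int (cdim (skew_mats :: (complex^('k \<times> 2)^('k \<times> 2)) set)) - 2)) \<and>
      (\<forall>l::real. l > 0 \<longrightarrow>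
         sphere_may_be_taken
           (complex_link (skew_mats :: (complex^('k \<times> 2)^('k \<times> 2)) set) skew_trace
              (of_real (real CARD('k) * l)))
           (int (cdim (skew_mats :: (complex^('k \<times> 2)^('k \<times> 2)) set)) - 2)
           {A \<in> degenerate skew_mats. quaternionic_matrix A \<and>
              skew_trace A = of_real (real CARD('k) * l) \<and>
              (\<forall>\<mu>. skew_eigenvalue A \<mu> \<longrightarrow> \<mu> \<in> \<real>\<^sub>\<ge>\<^sub>0)}))"
proof (intro conjI allI impI)
  interpret sym: star_space "sym_mats :: (complex^'n^'n) set" by (rule star_space_sym_mats)
  interpret sq: star_space "sq_mats :: (complex^'n^'n) set" by (rule star_space_sq_mats)
  interpret skew: star_space "skew_space :: (complex^('k \<times> 2)^('k \<times> 2)) set"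
    by (rule star_space_skew_space)
  {
    fix \<alpha> :: complex assume \<alpha>: "\<alpha> \<noteq> 0"
    show "top_of_set (complex_link (sym_mats :: (complex^'n^'n) set) trace \<alpha>)
        homotopy_equivalent_space sphere_space (int (cdim (sym_mats :: (complex^'n^'n) set)) - 2)"
      using \<alpha> by (rule sym.complex_link_homotopy_sphere)
    show "top_of_set (complex_link (sq_mats :: (complex^'n^'n) set) trace \<alpha>)
        homotopy_equivalent_space sphere_space (int (cdim (sq_mats :: (complex^'n^'n) set)) - 2)"
      using \<alpha> by (rule sq.complex_link_homotopy_sphere)
    have "top_of_set (complex_link (skew_mats :: (complex^('k \<times> 2)^('k \<times> 2)) set) skew_trace \<alpha>)
        homeomorphic_space top_of_set (complex_link (skew_space :: (complex^('k \<times> 2)^('k \<times> 2)) set) trace (2 * \<alpha>))"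
      unfolding complex_link_skew_mats
      by (subst homeomorphic_space_sym) (rule homeomorphic_space_mult_skew_unit)
    moreover have "top_of_set (complex_link (skew_space :: (complex^('k \<times> 2)^('k \<times> 2)) set) trace (2 * \<alpha>))
        homotopy_equivalent_space sphere_space (int (cdim (skew_mats :: (complex^('k \<times> 2)^('k \<times> 2)) set)) - 2)"
      unfolding cdim_skew_mats using \<alpha> by (intro skew.complex_link_homotopy_sphere) simp
    ultimately show "top_of_set (complex_link (skew_mats :: (complex^('k \<times> 2)^('k \<times> 2)) set) skew_trace \<alpha>)
        homotopy_equivalent_space sphere_space (int (cdim (skew_mats :: (complex^('k \<times> 2)^('k \<times> 2)) set)) - 2)"
      by (rule homotopy_eqv_trans[OF homeomorphic_imp_homotopy_equivalent_space])
  }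
  {
    fix l :: real assume l: "l > 0"
    show "sphere_may_be_taken (complex_link (sym_mats :: (complex^'n^'n) set) trace (of_real (real CARD('n) * l)))
        (int (cdim (sym_mats :: (complex^'n^'n) set)) - 2)
        {A \<in> degenerate sym_mats. real_matrix A \<and> trace A = of_real (real CARD('n) * l) \<and>
          (\<forall>\<mu>. eigenvalue A \<mu> \<longrightarrow> \<mu> \<in> \<real>\<^sub>\<ge>\<^sub>0)}"
      unfolding sym_sphere_eq using l by (intro sym.sphere_in_complex_link) simp
    show "sphere_may_be_taken (complex_link (sq_mats :: (complex^'n^'n) set) trace (of_real (real CARD('n) * l)))
        (int (cdim (sq_mats :: (complex^'n^'n) set)) - 2)
        {A \<in> degenerate sq_mats. hermitian_matrix A \<and> trace A = of_real (real CARD('n) * l) \<and>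
          (\<forall>\<mu>. eigenvalue A \<mu> \<longrightarrow> \<mu> \<in> \<real>\<^sub>\<ge>\<^sub>0)}"
      unfolding sq_sphere_eq using l by (intro sq.sphere_in_complex_link) simp
    have "sphere_may_be_taken
        (complex_link (skew_space :: (complex^('k \<times> 2)^('k \<times> 2)) set) trace (of_real (2 * (real CARD('k) * l))))
        (int (cdim (skew_space :: (complex^('k \<times> 2)^('k \<times> 2)) set)) - 2)
        {B \<in> complex_link skew_space trace (of_real (2 * (real CARD('k) * l))). psd B}"
      using l by (intro skew.sphere_in_complex_link) simp
    then show "sphere_may_be_taken (complex_link (skew_mats :: (complex^('k \<times> 2)^('k \<times> 2)) set) skew_trace
          (of_real (real CARD('k) * l)))
        (int (cdim (skew_mats :: (complex^('k \<times> 2)^('k \<times> 2)) set)) - 2)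
        {A \<in> degenerate skew_mats. quaternionic_matrix A \<and> skew_trace A = of_real (real CARD('k) * l) \<and>
          (\<forall>\<mu>. skew_eigenvalue A \<mu> \<longrightarrow> \<mu> \<in> \<real>\<^sub>\<ge>\<^sub>0)}"
      unfolding skew_sphere_eq complex_link_skew_mats cdim_skew_mats
      using sphere_may_be_taken_mult_skew_unit by simp
  }
qed

end
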